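(* Let $F$ be a Ferrers shape, let $n\ge 0$ be an integer and let $s,t$ be positive integers. Let $N(F;n;\mathit{NE}=s,\mathit{SE}=t)$ denote the number of $0$-$1$-fillings of $F$ with exactly $n$ entries equal to $1$ such that every row and every column of $F$ contains at most one $1$, the longest NE-chain has length $s$, and the longest SE-chain (among SE-chains whose smallest enclosing rectangle is contained in $F$) has length $t$. Then $$N(F;n;\mathit{NE}=s,\mathit{SE}=t)=N(F;n;\mathit{NE}=t,\mathit{SE}=s).$$
   Context: A Ferrers shape (in French notation) is a finite set of unit cells arranged in columns $1,\dots,m$ from left to right and rows numbered from the bottom, where column $j$ consists of the cells in rows $1,\dots,h_j$ and $h_1\ge h_2\ge\dots\ge h_m\ge 1$ (so it has a straight left side, a straight bottom side, and the columns weakly decrease in height from left to right). A $0$-$1$-filling assigns $0$ or $1$ to every cell. An NE-chain is a sequence of cells containing $1$ such that each cell in the sequence lies strictly above and strictly to the right of the preceding one; an SE-chain is a sequence of cells containing $1$ such that each lies strictly below and strictly to the right of the preceding one. The length of a chain is the number of its cells. The smallest rectangle containing a chain is the set of cells whose column lies between the columns of the first and last cells and whose row lies between the rows of the first and last cells; for SE-chains only those whose smallest rectangle lies entirely in $F$ are considered (for NE-chains this holds automatically). *)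

theory Defs
  imports Main "HOL-Library.FuncSet"
begin

text \<open>A cell is a pair (column, row), both counted from 1; rows are counted from the bottom.\<close>

type_synonym cell = "nat \<times> nat"

definition ferrers_cells :: "nat list \<Rightarrow> cell set" where
  "ferrers_cells hs = {(j, i). 1 \<le> j \<and> j \<le> length hs \<and> 1 \<le> i \<and> i \<le> hs ! (j - 1)}"

definition ferrers_shape :: "cell set \<Rightarrow> bool" where
  "ferrers_shape F \<longleftrightarrow>
     (\<exists>hs. sorted_wrt (\<ge>) hs \<and> (\<forall>h \<in> set hs. 1 \<le> h) \<and> F = ferrers_cells hs)"

definition fillings :: "cell set \<Rightarrow> (cell \<Rightarrow> nat) set" where
  "fillings F = F \<rightarrow>\<^sub>E {0, 1}"

definition ones :: "cell set \<Rightarrow> (cell \<Rightarrow> nat) \<Rightarrow> cell set" where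
  "ones F f = {c \<in> F. f c = 1}"

definition at_most_one_per_line :: "cell set \<Rightarrow> (cell \<Rightarrow> nat) \<Rightarrow> bool" where
  "at_most_one_per_line F f \<longleftrightarrow>
     (\<forall>j. card {c \<in> ones F f. fst c = j} \<le> 1) \<and>
     (\<forall>i. card {c \<in> ones F f. snd c = i} \<le> 1)"

definition NE_chain :: "cell set \<Rightarrow> (cell \<Rightarrow> nat) \<Rightarrow> cell list \<Rightarrow> bool" where
  "NE_chain F f cs \<longleftrightarrow>
     set cs \<subseteq> ones F f \<and> successively (\<lambda>c d. fst c < fst d \<and> snd c < snd d) cs"

definition SE_chain :: "cell set \<Rightarrow> (cell \<Rightarrow> nat) \<Rightarrow> cell list \<Rightarrow> bool" where
  "SE_chain F f cs \<longleftrightarrow>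
     set cs \<subseteq> ones F f \<and> successively (\<lambda>c d. fst c < fst d \<and> snd c > snd d) cs"

text \<open>
  The rectangle spanned by the first and last cell of a chain; the positions in it need not
  belong to the shape.
\<close>

definition enclosing_rectangle :: "cell list \<Rightarrow> cell set" where
  "enclosing_rectangle cs =
     (if cs = [] then {}
      else {(j, i).
        min (fst (hd cs)) (fst (last cs)) \<le> j \<and> j \<le> max (fst (hd cs)) (fst (last cs)) \<and>
        min (snd (hd cs)) (snd (last cs)) \<le> i \<and> i \<le> max (snd (hd cs)) (snd (last cs))})"

text \<open>
  The empty list is a chain, so both maxima range over nonempty sets; they are finite
  whenever the shape is, since the cells of a chain are distinct.
\<close>

definition longest_NE :: "cell set \<Rightarrow> (cell \<Rightarrow> nat) \<Rightarrow> nat" where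
  "longest_NE F f = Max {length cs | cs. NE_chain F f cs}"

definition longest_SE :: "cell set \<Rightarrow> (cell \<Rightarrow> nat) \<Rightarrow> nat" where
  "longest_SE F f = Max {length cs | cs. SE_chain F f cs \<and> enclosing_rectangle cs \<subseteq> F}"

definition num_fillings :: "cell set \<Rightarrow> nat \<Rightarrow> nat \<Rightarrow> nat \<Rightarrow> nat" where
  "num_fillings F n s t =
     card {f \<in> fillings F. card (ones F f) = n \<and> at_most_one_per_line F f \<and>
             longest_NE F f = s \<and> longest_SE F f = t}"

end

theory Submission imports Defs begin

text \<open>
  Krattenthaler's argument: attach to every lattice point \<open>(x, y)\<close> the partition computed from the
  filling by Fomin's local rules. These rules are invertible, so a filling of the shape is the same
  thing as a sequence of partitions along its north-east boundary in which neighbours differ by at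
  most one box. The first row and the first column of the partition at a boundary point are the
  lengths of the longest NE- and SE-chains in the rectangle below it, and a column of the shape
  contains a one iff the partition changes across it at the boundary. Hence conjugating all
  boundary partitions swaps the two statistics and keeps the number of ones.

  The first row obeys the same recursion as the longest NE-chain. For the first column, the rows
  from the second on form the growth diagram of Viennot's derived filling, whose longest SE-chain
  is shorter by one.
\<close>

section \<open>Partitions\<close>

text \<open>Row lengths are indexed from 0 and padded by zeros, so partitions with different numbers
  of rows can be compared pointwise.\<close>

definition is_partition :: "(nat \<Rightarrow> nat) \<Rightarrow> bool" where
  "is_partition p \<longleftrightarrow> antimono p \<and> (\<exists>n. p n = 0)"

definition conjugate :: "(nat \<Rightarrow> nat) \<Rightarrow> nat \<Rightarrow> nat" where
  "conjugate p j = (LEAST i. p i \<le> j)"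

definition add_box :: "nat \<Rightarrow> (nat \<Rightarrow> nat) \<Rightarrow> nat \<Rightarrow> nat" where
  "add_box r p = p(r := Suc (p r))"

definition step :: "(nat \<Rightarrow> nat) \<Rightarrow> (nat \<Rightarrow> nat) \<Rightarrow> bool" where
  "step p q \<longleftrightarrow> q = p \<or> (\<exists>r. q = add_box r p)"

lemma add_box_apply: "add_box r p i = (if i = r then Suc (p i) else p i)"
  by (simp add: add_box_def)

lemma add_box_inject [simp]: "add_box r p = add_box r q \<longleftrightarrow> p = q"
  by (auto simp: add_box_apply fun_eq_iff split: if_splits)

lemma step_refl [simp]: "step p p"
  by (simp add: step_def)

lemma step_add_box [simp]: "step p (add_box r p)"
  by (auto simp: step_def)

lemma stepE:
  assumes "step p q"
  obtains "q = p" | r where "q = add_box r p"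
  using assms by (auto simp: step_def)

lemma step_le: "step p q \<Longrightarrow> p i \<le> q i"
  by (auto simp: step_def add_box_apply)

lemma step_le_Suc: "step p q \<Longrightarrow> q i \<le> Suc (p i)"
  by (auto simp: step_def add_box_apply)

lemma partitionD: "is_partition p \<Longrightarrow> i \<le> j \<Longrightarrow> p j \<le> p i"
  by (auto simp: is_partition_def antimono_def)

lemma partition_zero [simp]: "is_partition (\<lambda>_. 0)"
  by (simp add: is_partition_def antimono_def)

lemma partitionI:
  assumes "\<And>i. p (Suc i) \<le> p i" "p n = 0"
  shows "is_partition p"
  unfolding is_partition_def antimono_iff_le_Suc using assms by auto

text \<open>Both sides say that the diagram has a box in row \<open>i\<close> and column
  \<open>j\<close>. Equalities between conjugates reduce to this through
  \<open>eq_if_same_less\<close>.\<close>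

lemma less_conjugate_iff:
  assumes "is_partition p"
  shows "i < conjugate p j \<longleftrightarrow> j < p i"
proof
  show "i < conjugate p j \<Longrightarrow> j < p i"
    unfolding conjugate_def using not_less_Least by fastforce
next
  assume j: "j < p i"
  obtain n where "p n = 0" using assms by (auto simp: is_partition_def)
  hence "p (LEAST i. p i \<le> j) \<le> j"
    by (simp add: LeastI[where P = "\<lambda>i. p i \<le> j" and k = n])
  thus "i < conjugate p j"
    unfolding conjugate_def using j partitionD[OF assms, of "LEAST i. p i \<le> j" i] by linarith
qed

lemma eq_if_same_less: "(\<And>i. i < a \<longleftrightarrow> i < b) \<Longrightarrow> a = (b::nat)"
  by (meson linorder_neqE_nat less_irrefl)

lemma partition_conjugate:
  assumes "is_partition p"
  shows "is_partition (conjugate p)"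
proof (rule partitionI)
  fix i
  have "k < conjugate p (Suc i) \<Longrightarrow> k < conjugate p i" for k
    using assms by (simp add: less_conjugate_iff)
  thus "conjugate p (Suc i) \<le> conjugate p i" by (meson less_irrefl not_le)
next
  have "\<not> k < conjugate p (p 0)" for k
    using partitionD[OF assms, of 0 k] by (simp add: less_conjugate_iff[OF assms])
  thus "conjugate p (p 0) = 0" by blast
qed

lemma conjugate_conjugate:
  assumes "is_partition p"
  shows "conjugate (conjugate p) = p"
  by (rule ext, rule eq_if_same_less)
    (simp add: less_conjugate_iff assms partition_conjugate)

lemma conjugate_inject: "is_partition p \<Longrightarrow> is_partition q \<Longrightarrow> conjugate p = conjugate q \<longleftrightarrow> p = q"
  by (metis conjugate_conjugate)

lemma conjugate_zero: "conjugate (\<lambda>_. 0) = (\<lambda>_. 0)"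
  by (rule ext, rule eq_if_same_less) (simp add: less_conjugate_iff)

text \<open>A box added in row \<open>r\<close> lies in column \<open>p r\<close>, so the conjugate
  gains a box in row \<open>p r\<close>.\<close>

lemma step_conjugate:
  assumes p: "is_partition p" and q: "is_partition q" and st: "step p q"
  shows "step (conjugate p) (conjugate q)"
  using st
proof (cases rule: stepE)
  case (2 r)
  \<comment> \<open>\<open>q\<close> is a partition, so in \<open>p\<close> every row before
    \<open>r\<close> must leave room for the new box.\<close>
  have less: "i < r \<Longrightarrow> p r < p i" for i
    using partitionD[OF q, of i r] by (simp add: 2 add_box_apply)
  have ge: "r \<le> i \<Longrightarrow> p i \<le> p r" for i
    using partitionD[OF p, of r i] by simp
  have "conjugate q = add_box (p r) (conjugate p)"
  proof (rule ext, rule eq_if_same_less)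
    fix j i
    have "conjugate p (p r) = r"
      using less ge by (intro eq_if_same_less) (metis less_conjugate_iff[OF p] not_le)
    thus "i < conjugate q j \<longleftrightarrow> i < add_box (p r) (conjugate p) j"
      using less[of i] ge[of i]
      by (cases "j = p r"; cases "i < r")
        (auto simp: less_conjugate_iff[OF q[unfolded 2]] less_conjugate_iff[OF p] add_box_apply 2 not_less)
  qed
  thus ?thesis by simp
qed simp

section \<open>The local rule\<close>

text \<open>
  The formula merges the cases of Fomin's rule: if \<open>\<mu> \<noteq> \<nu>\<close> it gives their union, if \<open>\<mu> = \<nu>\<close>
  arises from \<open>\<rho>\<close> by adding a box in row \<open>r\<close> it adds a box in row \<open>r + 1\<close>, and if all three agree
  it adds \<open>b\<close> boxes in row \<open>0\<close>.
\<close>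

definition grow :: "nat \<Rightarrow> (nat \<Rightarrow> nat) \<Rightarrow> (nat \<Rightarrow> nat) \<Rightarrow> (nat \<Rightarrow> nat) \<Rightarrow> nat \<Rightarrow> nat" where
  "grow b \<rho> \<mu> \<nu> i =
     max (\<mu> i) (\<nu> i) + (case i of 0 \<Rightarrow> b | Suc j \<Rightarrow> min (\<mu> j) (\<nu> j) - \<rho> j)"

lemma grow_commute: "grow b \<rho> \<mu> \<nu> = grow b \<rho> \<nu> \<mu>"
  by (simp add: grow_def fun_eq_iff max.commute min.commute split: nat.splits)

lemma grow_ge1: "\<mu> i \<le> grow b \<rho> \<mu> \<nu> i"
  by (simp add: grow_def)

lemma grow_ge2: "\<nu> i \<le> grow b \<rho> \<mu> \<nu> i"
  by (simp add: grow_def)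

lemma grow_one: "grow 1 \<rho> \<rho> \<rho> = add_box 0 \<rho>"
  by (auto simp: grow_def fun_eq_iff add_box_apply split: nat.splits)

lemma grow_left: "step \<rho> \<nu> \<Longrightarrow> grow 0 \<rho> \<rho> \<nu> = \<nu>"
  by (auto simp: grow_def fun_eq_iff add_box_apply step_def split: nat.splits)

lemma grow_bump: "grow 0 \<rho> (add_box r \<rho>) (add_box r \<rho>) = add_box (Suc r) (add_box r \<rho>)"
  by (auto simp: grow_def fun_eq_iff add_box_apply split: nat.splits)

lemma grow_distinct:
  "r \<noteq> s \<Longrightarrow> grow 0 \<rho> (add_box r \<rho>) (add_box s \<rho>) = add_box s (add_box r \<rho>)"
  by (auto simp: grow_def fun_eq_iff add_box_apply split: nat.splits)

text \<open>A case split along Fomin's rule. The edge out of \<open>\<nu>\<close> follows with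
  \<open>grow_commute\<close>.\<close>

lemma step_grow:
  assumes "step \<rho> \<mu>" "step \<rho> \<nu>" "b \<le> 1" "b = 1 \<Longrightarrow> \<mu> = \<rho> \<and> \<nu> = \<rho>"
  shows "step \<mu> (grow b \<rho> \<mu> \<nu>)"
proof (cases "b = 1")
  case True
  thus ?thesis using assms(4) by (simp add: grow_one[simplified])
next
  case False
  hence b: "b = 0" using assms(3) by simp
  from assms(1) show ?thesis
  proof (cases rule: stepE)
    case 1
    thus ?thesis using assms(2) by (simp add: b grow_left)
  next
    case r: (2 r)
    from assms(2) show ?thesis
    proof (cases rule: stepE)
      case 1
      thus ?thesis using assms(1) by (simp add: b grow_left grow_commute[of 0 \<rho> \<mu>])
    next
      case (2 s)
      thus ?thesis using r by (cases "r = s") (simp_all add: b grow_bump grow_distinct)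
    qed
  qed
qed

text \<open>A box is bumped into row \<open>Suc i\<close> only if \<open>\<mu>\<close> and
  \<open>\<nu>\<close> both added a box in row \<open>i\<close>, and that box makes room for it.
  Otherwise row \<open>Suc i\<close> is just the maximum of two rows, and those decrease.\<close>

lemma grow_Suc_le:
  assumes "step \<rho> \<mu>" "step \<rho> \<nu>" "is_partition \<rho>" "is_partition \<mu>" "is_partition \<nu>"
  shows "grow b \<rho> \<mu> \<nu> (Suc i) \<le> grow b \<rho> \<mu> \<nu> i"
proof (cases "\<mu> i > \<rho> i \<and> \<nu> i > \<rho> i")
  case True
  hence "\<mu> = add_box i \<rho>" "\<nu> = add_box i \<rho>"
    using assms(1,2) by (auto simp: step_def add_box_apply split: if_splits)
  thus ?thesis
    using partitionD[OF assms(3), of i "Suc i"] by (simp add: grow_def add_box_apply)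
next
  case False
  hence "min (\<mu> i) (\<nu> i) - \<rho> i = 0" by auto
  thus ?thesis
    using partitionD[OF assms(4), of i "Suc i"] partitionD[OF assms(5), of i "Suc i"]
    by (auto simp: grow_def)
qed

text \<open>Row 0 of the result reveals the entry, row \<open>Suc i\<close> reveals
  \<open>\<rho> i\<close>. The inequalities keep the truncated subtraction injective.\<close>

lemma grow_inverse_unique:
  assumes "\<And>i. \<rho> i \<le> \<mu> i" "\<And>i. \<rho> i \<le> \<nu> i" "\<And>i. \<rho>' i \<le> \<mu> i" "\<And>i. \<rho>' i \<le> \<nu> i"
    and eq: "grow b \<rho> \<mu> \<nu> = grow b' \<rho>' \<mu> \<nu>"
  shows "b = b'" "\<rho> = \<rho>'"
proof -
  show "b = b'" using fun_cong[OF eq, of 0] by (simp add: grow_def)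
  show "\<rho> = \<rho>'"
  proof
    fix i
    have "min (\<mu> i) (\<nu> i) - \<rho> i = min (\<mu> i) (\<nu> i) - \<rho>' i"
      using fun_cong[OF eq, of "Suc i"] by (simp add: grow_def)
    thus "\<rho> i = \<rho>' i" using assms(1-4)[of i] by (auto simp: min_def split: if_splits)
  qed
qed

lemma partition_min:
  assumes "is_partition \<mu>" "is_partition \<nu>"
  shows "is_partition (\<lambda>i. min (\<mu> i) (\<nu> i))"
proof -
  obtain n where "\<mu> n = 0" using assms by (auto simp: is_partition_def)
  thus ?thesis
    using partitionD[OF assms(1)] partitionD[OF assms(2)]
    by (intro partitionI[of _ n]) (auto simp: min_le_iff_disj)
qed

text \<open>The backward rule. If \<open>\<kappa>\<close> equals one neighbour,
  \<open>\<rho>\<close> is the other one. If the two added boxes differ, \<open>\<rho>\<close> is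
  the rowwise minimum. If they agree, a box in row 0 comes from an entry 1, and a box in a later row
  was bumped from the row before.\<close>

lemma grow_inverse_exists:
  assumes "is_partition \<kappa>" "is_partition \<mu>" "is_partition \<nu>" "step \<mu> \<kappa>" "step \<nu> \<kappa>"
  obtains \<rho> b where "is_partition \<rho>" "step \<rho> \<mu>" "step \<rho> \<nu>" "b \<le> 1"
    "b = 1 \<Longrightarrow> \<mu> = \<rho> \<and> \<nu> = \<rho>" "\<kappa> = grow b \<rho> \<mu> \<nu>"
  using assms(4)
proof (cases rule: stepE)
  case 1
  thus thesis using assms by (intro that[of \<nu> 0]) (auto simp: grow_left grow_commute[of 0 \<nu> \<mu>])
next
  case r: (2 r)
  from assms(5) show thesis
  proof (cases rule: stepE)
    case 1
    thus thesis using assms by (intro that[of \<mu> 0]) (auto simp: grow_left)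
  next
    case s: (2 s)
    show thesis
    proof (cases "r = s")
      case True
      hence eq: "\<nu> = \<mu>" using r s by simp
      show thesis
      proof (cases r)
        case 0
        thus thesis using assms eq r by (intro that[of \<mu> 1]) (auto simp: grow_one[simplified])
      next
        case (Suc k)
        \<comment> \<open>This undoes the bump by taking the last box of row \<open>k\<close> away.
          Row \<open>k\<close> is long enough because \<open>\<kappa>\<close> is still a partition
          with one more box in row \<open>Suc k\<close>.\<close>
        define \<rho> where "\<rho> = \<mu>(k := \<mu> k - 1)"
        have gt: "\<mu> (Suc k) < \<mu> k"
          using partitionD[OF assms(1), of k "Suc k"] by (simp add: r Suc add_box_apply)
        hence \<mu>: "\<mu> = add_box k \<rho>" by (auto simp: \<rho>_def add_box_apply fun_eq_iff)
        obtain n where n: "\<mu> n = 0" using assms by (auto simp: is_partition_def)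
        have "is_partition \<rho>"
        proof (rule partitionI)
          show "\<rho> n = 0" using n by (auto simp: \<rho>_def)
          show "\<rho> (Suc i) \<le> \<rho> i" for i
            using gt partitionD[OF assms(2), of i "Suc i"] by (auto simp: \<rho>_def)
        qed
        thus thesis using r Suc eq \<mu>
          by (intro that[of \<rho> 0]) (simp_all add: grow_bump)
      qed
    next
      case False
      define \<rho> where "\<rho> = (\<lambda>i. min (\<mu> i) (\<nu> i))"
      have e: "add_box r \<mu> i = add_box s \<nu> i" for i using r s by simp
      have \<mu>: "\<mu> = add_box s \<rho>"
      proof
        fix i show "\<mu> i = add_box s \<rho> i"
          using e[of i] False by (auto simp: \<rho>_def add_box_apply split: if_splits)
      qed
      have \<nu>: "\<nu> = add_box r \<rho>"
      proof
        fix i show "\<nu> i = add_box r \<rho> i"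
          using e[of i] False by (auto simp: \<rho>_def add_box_apply split: if_splits)
      qed
      have part: "is_partition \<rho>" unfolding \<rho>_def by (rule partition_min) fact+
      have gr: "\<kappa> = grow 0 \<rho> \<mu> \<nu>"
        using r False by (simp add: \<mu> \<nu> grow_distinct)
      have "step \<rho> \<mu>" unfolding \<mu> by (rule step_add_box)
      moreover have "step \<rho> \<nu>" unfolding \<nu> by (rule step_add_box)
      ultimately show thesis by (rule that[OF part _ _ _ _ gr]) simp_all
    qed
  qed
qed

section \<open>Growth diagrams\<close>

fun growth :: "(cell \<Rightarrow> nat) \<Rightarrow> nat \<Rightarrow> nat \<Rightarrow> nat \<Rightarrow> nat" where
  "growth w 0 y = (\<lambda>_. 0)"
| "growth w (Suc x) 0 = (\<lambda>_. 0)"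
| "growth w (Suc x) (Suc y) =
     grow (w (Suc x, Suc y)) (growth w x y) (growth w x (Suc y)) (growth w (Suc x) y)"

lemma growth_0_right [simp]: "growth w x 0 = (\<lambda>_. 0)"
  by (cases x) auto

text \<open>The local rule is symmetric in its two neighbours, so reflection in the diagonal turns
  statements on columns and upward rays into those on rows and rightward rays.\<close>

lemma growth_swap: "growth (w \<circ> prod.swap) x y = growth w y x"
proof (induction w x y rule: growth.induct)
  case (3 w x y)
  thus ?case by (simp add: grow_commute[of _ "growth w y x" "growth w (Suc y) x"])
qed simp_all

lemma growth_cong:
  assumes "\<And>i j. \<lbrakk>0 < i; i \<le> x; 0 < j; j \<le> y\<rbrakk> \<Longrightarrow> w (i, j) = w' (i, j)"
  shows "growth w x y = growth w' x y"
  using assms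
proof (induction w x y rule: growth.induct)
  case (3 w x y)
  have "growth w x y = growth w' x y" "growth w x (Suc y) = growth w' x (Suc y)"
    "growth w (Suc x) y = growth w' (Suc x) y"
    by (intro 3; use 3(4) in simp)+
  thus ?case using 3(4)[of "Suc x" "Suc y"] by simp
qed simp_all

lemma growth_mono_Suc_left: "growth w x y i \<le> growth w (Suc x) y i"
  by (cases y) (simp_all add: grow_ge1)

lemma growth_mono_Suc_right: "growth w x y i \<le> growth w x (Suc y) i"
  by (cases x) (simp_all add: grow_ge2)

lemma growth_mono: "x \<le> x' \<Longrightarrow> y \<le> y' \<Longrightarrow> growth w x y i \<le> growth w x' y' i"
  by (rule order_trans[OF lift_Suc_mono_le[of "\<lambda>x. growth w x y i"]
        lift_Suc_mono_le[of "\<lambda>y. growth w x' y i"]])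
    (auto intro: growth_mono_Suc_left growth_mono_Suc_right)

text \<open>This makes the ones visible on the boundary: whether a column has a one up to height
  \<open>y\<close> depends only on the two partitions at height \<open>y\<close>.\<close>

lemma growth_column_empty_iff:
  "growth w (Suc x) y = growth w x y \<longleftrightarrow> (\<forall>j. 0 < j \<and> j \<le> y \<longrightarrow> w (Suc x, j) = 0)"
proof (induction y)
  case (Suc y)
  let ?\<rho> = "growth w x y" and ?\<mu> = "growth w x (Suc y)" and ?\<nu> = "growth w (Suc x) y"
    and ?\<kappa> = "growth w (Suc x) (Suc y)" and ?b = "w (Suc x, Suc y)"
  have le: "?\<rho> i \<le> ?\<mu> i" "?\<rho> i \<le> ?\<nu> i" for i
    by (rule growth_mono_Suc_right growth_mono_Suc_left)+
  \<comment> \<open>If row \<open>i\<close> does not grow from \<open>?\<mu>\<close> to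
    \<open>?\<kappa>\<close> then \<open>?\<nu> i \<le> ?\<mu> i\<close>. If nothing is bumped into
    row \<open>Suc i\<close> then \<open>?\<nu> i\<close> cannot exceed
    \<open>?\<rho> i\<close>.\<close>
  have "?\<kappa> = ?\<mu> \<longleftrightarrow> ?\<nu> = ?\<rho> \<and> ?b = 0"
  proof
    assume eq: "?\<kappa> = ?\<mu>"
    have "?\<nu> i = ?\<rho> i" for i
    proof -
      have "?\<kappa> i = ?\<mu> i" "?\<kappa> (Suc i) = ?\<mu> (Suc i)" using eq by simp_all
      thus ?thesis using le[of i]
        by (auto simp: grow_def max_def min_def split: if_splits nat.splits)
    qed
    moreover have "?b = 0" using fun_cong[OF eq, of 0] by (simp add: grow_def max_def split: if_splits)
    ultimately show "?\<nu> = ?\<rho> \<and> ?b = 0" by auto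
  next
    assume eq: "?\<nu> = ?\<rho> \<and> ?b = 0"
    show "?\<kappa> = ?\<mu>"
    proof
      fix i show "?\<kappa> i = ?\<mu> i" using eq le
        by (cases i) (simp_all add: grow_def max_absorb1)
    qed
  qed
  thus ?case using Suc by (auto simp: le_Suc_eq)
qed simp

lemma growth_row_empty_iff:
  "growth w x (Suc y) = growth w x y \<longleftrightarrow> (\<forall>i. 0 < i \<and> i \<le> x \<longrightarrow> w (i, Suc y) = 0)"
  using growth_column_empty_iff[of "w \<circ> prod.swap" y x] by (simp add: growth_swap)

section \<open>Growth diagrams of partial permutation matrices\<close>

definition partial_perm :: "(cell \<Rightarrow> nat) \<Rightarrow> bool" where
  "partial_perm w \<longleftrightarrow> (\<forall>c. w c \<le> 1) \<and> (\<forall>x. w (x, 0) = 0) \<and> (\<forall>y. w (0, y) = 0) \<and>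
     (\<forall>x y y'. w (x, y) = 1 \<longrightarrow> w (x, y') = 1 \<longrightarrow> y = y') \<and>
     (\<forall>x x' y. w (x, y) = 1 \<longrightarrow> w (x', y) = 1 \<longrightarrow> x = x')"

lemma partial_perm_swap: "partial_perm w \<Longrightarrow> partial_perm (w \<circ> prod.swap)"
  unfolding partial_perm_def o_apply swap_simp by blast

lemma partial_perm_le_1: "partial_perm w \<Longrightarrow> w c \<le> 1"
  unfolding partial_perm_def by blast

lemma partial_perm_axes: "partial_perm w \<Longrightarrow> w (x, 0) = 0" "partial_perm w \<Longrightarrow> w (0, y) = 0"
  unfolding partial_perm_def by blast+

lemma partial_perm_column: "partial_perm w \<Longrightarrow> w (x, y) = 1 \<Longrightarrow> w (x, y') = 1 \<Longrightarrow> y = y'"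
  unfolding partial_perm_def by blast

lemma partial_perm_row: "partial_perm w \<Longrightarrow> w (x, y) = 1 \<Longrightarrow> w (x', y) = 1 \<Longrightarrow> x = x'"
  unfolding partial_perm_def by blast

lemma partial_perm_eq_0_iff: "partial_perm w \<Longrightarrow> w c = 0 \<longleftrightarrow> w c \<noteq> 1"
  using partial_perm_le_1[of w c] by linarith

text \<open>Row and column of a one are otherwise empty, so all three known corners of its square
  carry the same partition. This is the side condition for an entry 1 in
  \<open>step_grow\<close>.\<close>

lemma growth_at_one:
  assumes "partial_perm w" "w (Suc x, Suc y) = 1"
  shows "growth w (Suc x) y = growth w x y" "growth w x (Suc y) = growth w x y"
proof -
  have "w (Suc x, j) = 0" if "j \<le> y" for j
    using partial_perm_column[OF assms, of j] that partial_perm_eq_0_iff[OF assms(1)] by fastforce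
  thus "growth w (Suc x) y = growth w x y" by (simp add: growth_column_empty_iff)
  have "w (i, Suc y) = 0" if "i \<le> x" for i
    using partial_perm_row[OF assms, of i] that partial_perm_eq_0_iff[OF assms(1)] by fastforce
  thus "growth w x (Suc y) = growth w x y" by (simp add: growth_row_empty_iff)
qed

text \<open>Both directions are proved together, since the local rule at a square needs both edges
  at its south-west corner.\<close>

lemma growth_step:
  assumes "partial_perm w"
  shows "step (growth w x y) (growth w (Suc x) y) \<and> step (growth w x y) (growth w x (Suc y))"
proof (induction "x + y" arbitrary: x y rule: less_induct)
  case less
  have local: "step (growth w a (Suc b)) (growth w (Suc a) (Suc b)) \<and>
      step (growth w (Suc a) b) (growth w (Suc a) (Suc b))" if "a + b < x + y" for a b
  proof -
    have le: "w (Suc a, Suc b) \<le> 1" using assms by (simp add: partial_perm_def)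
    have one: "w (Suc a, Suc b) = 1 \<Longrightarrow>
        growth w a (Suc b) = growth w a b \<and> growth w (Suc a) b = growth w a b"
      using growth_at_one[OF assms, of a b] by blast
    have "step (growth w a (Suc b)) (growth w (Suc a) (Suc b))"
      unfolding growth.simps using less[OF that] one le by (intro step_grow) blast+
    moreover have "step (growth w (Suc a) b) (growth w (Suc a) (Suc b))"
      unfolding growth.simps grow_commute[of _ _ "growth w a (Suc b)"]
      using less[OF that] one le by (intro step_grow) blast+
    ultimately show ?thesis by blast
  qed
  \<comment> \<open>The horizontal edge is the top of the square below it, the vertical edge is the
    right side of the square to its left. Edges on the axes are trivial.\<close>
  show ?case
    using local[of x "y - 1"] local[of "x - 1" y] by (cases x; cases y) (auto simp del: growth.simps(3))
qed

lemma growth_support: "x \<le> i \<Longrightarrow> growth w x y i = 0"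
proof (induction w x y arbitrary: i rule: growth.induct)
  case (3 w x y)
  then obtain j where "i = Suc j" "x \<le> j" by (cases i) auto
  with 3 show ?case by (simp add: grow_def)
qed simp_all

lemma partition_growth:
  assumes "partial_perm w"
  shows "is_partition (growth w x y)"
  using assms
proof (induction w x y rule: growth.induct)
  case (3 w x y)
  show ?case
  proof (rule partitionI)
    show "growth w (Suc x) (Suc y) (Suc x) = 0" by (rule growth_support) simp
    show "growth w (Suc x) (Suc y) (Suc i) \<le> growth w (Suc x) (Suc y) i" for i
      using 3 growth_step[OF 3(4)] by (simp only: growth.simps) (intro grow_Suc_le; simp)
  qed
qed simp_all

section \<open>Chains in rectangles\<close>

definition rect_ones :: "(cell \<Rightarrow> nat) \<Rightarrow> nat \<Rightarrow> nat \<Rightarrow> cell set" where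
  "rect_ones w x y = {(i, j). 0 < i \<and> i \<le> x \<and> 0 < j \<and> j \<le> y \<and> w (i, j) = 1}"

abbreviation NE :: "cell \<Rightarrow> cell \<Rightarrow> bool" where
  "NE c d \<equiv> fst c < fst d \<and> snd c < snd d"

abbreviation SE :: "cell \<Rightarrow> cell \<Rightarrow> bool" where
  "SE c d \<equiv> fst c < fst d \<and> snd c > snd d"

lemma rect_ones_mono: "x \<le> x' \<Longrightarrow> y \<le> y' \<Longrightarrow> rect_ones w x y \<subseteq> rect_ones w x' y'"
  by (auto simp: rect_ones_def)

lemma growth_first_row:
  "growth w (Suc x) (Suc y) 0 =
     max (growth w x (Suc y) 0) (growth w (Suc x) y 0) + w (Suc x, Suc y)"
  by (simp add: grow_def)

text \<open>The bound is taken at the last cell of the chain instead of at \<open>(x, y)\<close>, so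
  that induction can remove that cell.\<close>

lemma NE_chain_le_growth:
  assumes "successively NE (cs @ [c])" "set (cs @ [c]) \<subseteq> rect_ones w x y"
  shows "Suc (length cs) \<le> growth w (fst c) (snd c) 0"
  using assms
proof (induction cs arbitrary: c rule: rev_induct)
  case Nil
  then obtain i j where "c = (Suc i, Suc j)" "w c = 1"
    by (cases c) (auto simp: rect_ones_def gr0_conv_Suc)
  thus ?case using growth_first_row[of w i j] by simp
next
  case (snoc d cs)
  then obtain i j where c: "c = (Suc i, Suc j)" "w c = 1"
    by (cases c) (auto simp: rect_ones_def gr0_conv_Suc)
  have "successively NE (cs @ [d])" and le: "fst d \<le> i" "snd d \<le> j"
    using snoc.prems(1) c by (auto simp: successively_append_iff)
  hence "Suc (length cs) \<le> growth w (fst d) (snd d) 0"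
    using snoc.prems by (intro snoc.IH) auto
  also have "\<dots> \<le> growth w i (Suc j) 0"
    using le by (intro growth_mono) auto
  finally show ?case using growth_first_row[of w i j] c by simp
qed

text \<open>A length not reached in the two smaller rectangles forces a one in the corner cell. By
  \<open>growth_at_one\<close> a chain one shorter then exists strictly below and to the left of
  it.\<close>

lemma NE_chain_of_growth:
  assumes "partial_perm w" "k \<le> growth w x y 0"
  shows "\<exists>cs. length cs = k \<and> set cs \<subseteq> rect_ones w x y \<and> successively NE cs"
  using assms
proof (induction w x y arbitrary: k rule: growth.induct)
  case (3 w x y)
  show ?case
  proof (cases "k \<le> growth w x (Suc y) 0 \<or> k \<le> growth w (Suc x) y 0")
    case True
    thus ?thesis using 3 rect_ones_mono[of x "Suc x" "Suc y" "Suc y" w]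
        rect_ones_mono[of "Suc x" "Suc x" y "Suc y" w] by (meson le_SucI order_refl subset_trans)
  next
    case False
    hence w: "w (Suc x, Suc y) = 1"
      using 3(4,5) partial_perm_eq_0_iff[of w "(Suc x, Suc y)"] unfolding growth_first_row by fastforce
    note eq = growth_at_one[OF 3(4) w]
    obtain k' where k: "k = Suc k'" using False by (cases k) auto
    hence "k' \<le> growth w x y 0"
      using 3(5) w unfolding growth_first_row eq by simp
    then obtain cs where cs: "length cs = k'" "set cs \<subseteq> rect_ones w x y" "successively NE cs"
      using 3(1,4) by blast
    have "successively NE (cs @ [(Suc x, Suc y)])"
    proof (cases "cs = []")
      case False
      hence "last cs \<in> rect_ones w x y" using cs(2) by auto
      thus ?thesis using cs(3) by (auto simp: successively_append_iff rect_ones_def)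
    qed simp
    moreover have "set (cs @ [(Suc x, Suc y)]) \<subseteq> rect_ones w (Suc x) (Suc y)"
      using cs(2) w by (auto simp: rect_ones_def)
    ultimately show ?thesis using cs(1) k by (intro exI[of _ "cs @ [(Suc x, Suc y)]"]) auto
  qed
qed simp_all

theorem NE_chain_iff_growth:
  assumes "partial_perm w"
  shows "(\<exists>cs. length cs = k \<and> set cs \<subseteq> rect_ones w x y \<and> successively NE cs) \<longleftrightarrow>
    k \<le> growth w x y 0"
proof
  assume "\<exists>cs. length cs = k \<and> set cs \<subseteq> rect_ones w x y \<and> successively NE cs"
  then obtain cs where cs: "length cs = k" "set cs \<subseteq> rect_ones w x y" "successively NE cs"
    by blast
  show "k \<le> growth w x y 0"
  proof (cases cs rule: rev_cases)
    case (snoc ds c)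
    hence "k \<le> growth w (fst c) (snd c) 0"
      using NE_chain_le_growth[of ds c w x y] cs by simp
    also have "\<dots> \<le> growth w x y 0"
      using cs(2) snoc by (intro growth_mono) (auto simp: rect_ones_def)
    finally show ?thesis .
  qed (use cs in simp)
qed (use NE_chain_of_growth[OF assms] in blast)

section \<open>The derived filling\<close>

text \<open>
  Viennot's shadow construction: every one emits a ray upwards and a ray to the right; two rays
  meeting in a cell from below and from the left annihilate each other there. The first row of the
  growth diagram counts rays, and the derived filling marks the cells of annihilation.
\<close>

fun derived :: "(cell \<Rightarrow> nat) \<Rightarrow> cell \<Rightarrow> nat" where
  "derived w (Suc x, Suc y) =
     min (growth w x (Suc y) 0) (growth w (Suc x) y 0) - growth w x y 0"
| "derived w (0, y) = 0"
| "derived w (Suc x, 0) = 0"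

lemma derived_0_right [simp]: "derived w (x, 0) = 0"
  by (cases x) auto

lemma derived_swap: "derived (w \<circ> prod.swap) (x, y) = derived w (y, x)"
  by (cases x; cases y) (simp_all add: growth_swap min.commute del: growth.simps(3))

text \<open>All rows after row 0 obey the same rule. Once row 0 is deleted, the box bumped out of it
  acts as the entry of the cell.\<close>

lemma grow_tail:
  "(\<lambda>i. grow b \<rho> \<mu> \<nu> (Suc i)) =
     grow (min (\<mu> 0) (\<nu> 0) - \<rho> 0) (\<lambda>i. \<rho> (Suc i)) (\<lambda>i. \<mu> (Suc i)) (\<lambda>i. \<nu> (Suc i))"
  by (auto simp: grow_def fun_eq_iff split: nat.splits)

lemma growth_tail: "(\<lambda>i. growth w x y (Suc i)) = growth (derived w) x y"
proof (induction w x y rule: growth.induct)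
  case (3 w x y)
  have "(\<lambda>i. growth w (Suc x) (Suc y) (Suc i)) =
      grow (derived w (Suc x, Suc y)) (\<lambda>i. growth w x y (Suc i))
        (\<lambda>i. growth w x (Suc y) (Suc i)) (\<lambda>i. growth w (Suc x) y (Suc i))"
    unfolding growth.simps(3)[of w] grow_tail derived.simps by (rule refl)
  thus ?case unfolding 3 growth.simps(3)[of "derived w"] .
qed simp_all

section \<open>Rays and the cells where they meet\<close>

definition up_ray :: "(cell \<Rightarrow> nat) \<Rightarrow> nat \<Rightarrow> nat \<Rightarrow> bool" where
  "up_ray w x y \<longleftrightarrow> growth w x y 0 < growth w (Suc x) y 0"

definition right_ray :: "(cell \<Rightarrow> nat) \<Rightarrow> nat \<Rightarrow> nat \<Rightarrow> bool" where
  "right_ray w x y \<longleftrightarrow> growth w x y 0 < growth w x (Suc y) 0"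

lemma up_ray_swap: "up_ray (w \<circ> prod.swap) x y = right_ray w y x"
  by (simp add: up_ray_def right_ray_def growth_swap)

text \<open>\<open>up_ray w x y\<close> concerns the ray of column \<open>Suc x\<close> crossing the
  edge from \<open>(x, y)\<close> to \<open>(Suc x, y)\<close>. Row 0 changes by at most one along
  edges, so a ray leaves a cell through its top iff it starts there or enters from below without
  meeting one from the left.\<close>

lemma up_ray_Suc:
  assumes "partial_perm w"
  shows "up_ray w x (Suc y) \<longleftrightarrow> w (Suc x, Suc y) = 1 \<or> up_ray w x y \<and> \<not> right_ray w x y"
proof -
  have "growth w x y 0 \<le> growth w x (Suc y) 0" "growth w x y 0 \<le> growth w (Suc x) y 0"
    "growth w x (Suc y) 0 \<le> Suc (growth w x y 0)" "growth w (Suc x) y 0 \<le> Suc (growth w x y 0)"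
    using growth_step[OF assms, of x y] step_le step_le_Suc by blast+
  thus ?thesis
    using partial_perm_le_1[OF assms, of "(Suc x, Suc y)"] growth_at_one[OF assms, of x y]
    unfolding up_ray_def right_ray_def growth_first_row
    by (cases "w (Suc x, Suc y) = 1") auto
qed

lemma derived_eq_1_iff:
  assumes "partial_perm w"
  shows "derived w (Suc x, Suc y) = 1 \<longleftrightarrow> up_ray w x y \<and> right_ray w x y"
    and "derived w c \<le> 1"
proof -
  have *: "growth w x y 0 \<le> growth w x (Suc y) 0" "growth w x y 0 \<le> growth w (Suc x) y 0"
    "growth w x (Suc y) 0 \<le> Suc (growth w x y 0)" "growth w (Suc x) y 0 \<le> Suc (growth w x y 0)"
    for x y
    using growth_step[OF assms, of x y] step_le step_le_Suc by blast+
  show "derived w (Suc x, Suc y) = 1 \<longleftrightarrow> up_ray w x y \<and> right_ray w x y"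
    using *[of x y] unfolding up_ray_def right_ray_def derived.simps by linarith
  show "derived w c \<le> 1"
  proof (cases "(w, c)" rule: derived.cases)
    case (1 w' x y)
    thus ?thesis using *[of x y] by (simp del: growth.simps)
  qed auto
qed

lemma derived_ends_up_ray:
  assumes "partial_perm w" "derived w (Suc x, Suc y) = 1"
  shows "\<not> up_ray w x (Suc y)"
  using assms(2) growth_at_one[OF assms(1), of x y]
  unfolding derived_eq_1_iff[OF assms(1)] up_ray_Suc[OF assms(1)] by (auto simp: up_ray_def)

text \<open>Follow the ray downwards to the one emitting it. The last conclusion says that the ray
  is unbroken above its source.\<close>

lemma up_ray_source:
  assumes "partial_perm w" "up_ray w x y"
  obtains j where "0 < j" "j \<le> y" "w (Suc x, j) = 1" "\<And>j'. j \<le> j' \<Longrightarrow> j' \<le> y \<Longrightarrow> up_ray w x j'"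
  using assms(2)
proof (induction y arbitrary: thesis)
  case 0
  thus ?case by (simp add: up_ray_def)
next
  case (Suc y)
  show ?case
  proof (cases "w (Suc x, Suc y) = 1")
    case True
    thus ?thesis using Suc.prems(2) by (intro Suc.prems(1)[of "Suc y"]) (auto dest: le_antisym)
  next
    case False
    hence "up_ray w x y" using Suc.prems(2) up_ray_Suc[OF assms(1)] by blast
    then obtain j where "0 < j" "j \<le> y" "w (Suc x, j) = 1"
      "\<And>j'. j \<le> j' \<Longrightarrow> j' \<le> y \<Longrightarrow> up_ray w x j'" using Suc.IH by blast
    thus ?thesis using Suc.prems(2) by (intro Suc.prems(1)[of j]) (auto simp: le_Suc_eq)
  qed
qed

lemma right_ray_source:
  assumes "partial_perm w" "right_ray w x y"
  obtains i where "0 < i" "i \<le> x" "w (i, Suc y) = 1" "\<And>i'. i \<le> i' \<Longrightarrow> i' \<le> x \<Longrightarrow> right_ray w i' y"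
  using up_ray_source[OF partial_perm_swap[OF assms(1)], of y x] assms(2)
  by (auto simp: up_ray_swap)

text \<open>Follow the ray upwards. It can stop only by annihilation, which is a derived
  one.\<close>

lemma up_ray_end:
  assumes "partial_perm w" "w (Suc x, j) = 1" "0 < j" "j \<le> y" "\<not> up_ray w x y"
  shows "\<exists>j'. j < j' \<and> j' \<le> y \<and> derived w (Suc x, j') = 1"
  using assms(4,5)
proof (induction y)
  case 0
  thus ?case using assms(3) by simp
next
  case (Suc y)
  have ne: "w (Suc x, Suc y) \<noteq> 1" using Suc.prems(2) up_ray_Suc[OF assms(1)] by blast
  hence le: "j \<le> y" using Suc.prems(1) assms(2) by (metis le_SucE)
  show ?case
  proof (cases "up_ray w x y")
    case True
    hence "derived w (Suc x, Suc y) = 1"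
      using Suc.prems(2) up_ray_Suc[OF assms(1)] derived_eq_1_iff(1)[OF assms(1)] by blast
    thus ?thesis using le by (intro exI[of _ "Suc y"]) simp
  next
    case False
    thus ?thesis using Suc.IH le by (meson le_SucI)
  qed
qed

lemma right_ray_end:
  assumes "partial_perm w" "w (i, Suc y) = 1" "0 < i" "i \<le> x" "\<not> right_ray w x y"
  shows "\<exists>i'. i < i' \<and> i' \<le> x \<and> derived w (i', Suc y) = 1"
  using up_ray_end[OF partial_perm_swap[OF assms(1)], of y i x] assms
  by (simp add: up_ray_swap derived_swap)

text \<open>After an annihilation the column has no ray, so a second one would need a new source
  higher up, hence a second one of \<open>w\<close> in that column.\<close>

lemma derived_column_unique:
  assumes "partial_perm w" "derived w (x, y) = 1" "derived w (x, y') = 1"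
  shows "\<not> y < y'"
proof
  assume "y < y'"
  obtain a b where ab: "x = Suc a" "y = Suc b" using assms(2) by (cases x; cases y) auto
  obtain b' where b': "y' = Suc b'" using assms(3) by (cases y') auto
  have "up_ray w a b" "up_ray w a b'"
    using assms(2,3) derived_eq_1_iff(1)[OF assms(1)] unfolding ab b' by blast+
  then obtain j j' where j: "j \<le> b" "w (x, j) = 1" and j': "j' \<le> b'" "w (x, j') = 1"
    "\<And>k. j' \<le> k \<Longrightarrow> k \<le> b' \<Longrightarrow> up_ray w a k"
    using up_ray_source[OF assms(1)] ab(1) by metis
  have "\<not> up_ray w a (Suc b)"
    using derived_ends_up_ray[OF assms(1)] assms(2) unfolding ab by blast
  hence "Suc b < j'" using j'(3)[of "Suc b"] \<open>y < y'\<close> ab b' by fastforce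
  moreover have "j = j'" using partial_perm_column[OF assms(1)] j j' by blast
  ultimately show False using j by simp
qed

lemma partial_perm_derived:
  assumes "partial_perm w"
  shows "partial_perm (derived w)"
proof -
  have col: "y = y'" if "derived w (x, y) = 1" "derived w (x, y') = 1" for x y y'
    using derived_column_unique[OF assms that] derived_column_unique[OF assms that(2,1)] by simp
  have row: "x = x'" if "derived w (x, y) = 1" "derived w (x', y) = 1" for x x' y
    using derived_column_unique[OF partial_perm_swap[OF assms], of y x x']
      derived_column_unique[OF partial_perm_swap[OF assms], of y x' x] that
    by (simp add: derived_swap)
  show ?thesis
    unfolding partial_perm_def using derived_eq_1_iff(2)[OF assms] derived_0_right derived.simps(2)
      col row by blast
qed

text \<open>The upward ray of the lower one and the rightward ray of the upper one both head for the
  cell \<open>(x2, y1)\<close>. They annihilate each other there, or one of them ends earlier; each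
  case yields a derived one.\<close>

lemma derived_between_ones:
  assumes "partial_perm w" "w (x1, y1) = 1" "w (x2, y2) = 1" "x1 < x2" "y2 < y1"
  obtains i j where "x1 < i" "i \<le> x2" "y2 < j" "j \<le> y1" "derived w (i, j) = 1"
proof -
  have pos: "0 < x1" "0 < y2"
    using assms(1-3) unfolding partial_perm_def by (metis gr0I zero_neq_one)+
  obtain a b where ab: "x2 = Suc a" "y1 = Suc b"
    using assms(4,5) by (meson less_imp_Suc_add)
  consider "\<not> up_ray w a b" | "\<not> right_ray w a b" | "derived w (x2, y1) = 1"
    using derived_eq_1_iff(1)[OF assms(1)] ab by blast
  thus thesis
  proof cases
    case 1
    then obtain j where "y2 < j" "j \<le> b" "derived w (x2, j) = 1"
      using up_ray_end[OF assms(1), of a y2 b] assms pos ab by auto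
    thus thesis using that[of x2 j] assms ab by simp
  next
    case 2
    then obtain i where "x1 < i" "i \<le> a" "derived w (i, y1) = 1"
      using right_ray_end[OF assms(1), of x1 b a] assms pos ab by auto
    thus thesis using that[of i y1] assms ab by simp
  next
    case 3
    thus thesis using that[of x2 y1] assms by simp
  qed
qed

text \<open>The candidates are the sources of the upward ray ending in \<open>(x1, y1)\<close> and
  of the rightward ray ending in \<open>(x2, y2)\<close>.\<close>

lemma one_between_derived:
  assumes "partial_perm w" "derived w (x1, y1) = 1" "derived w (x2, y2) = 1" "x1 < x2" "y2 < y1"
  obtains i j where "x1 \<le> i" "i < x2" "y2 \<le> j" "j < y1" "w (i, j) = 1"
proof -
  obtain a1 b1 where 1: "x1 = Suc a1" "y1 = Suc b1" using assms(2) by (cases x1; cases y1) auto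
  obtain a2 b2 where 2: "x2 = Suc a2" "y2 = Suc b2" using assms(3) by (cases x2; cases y2) auto
  have "up_ray w a1 b1" "right_ray w a2 b2"
    using assms(2,3) derived_eq_1_iff(1)[OF assms(1)] unfolding 1 2 by blast+
  obtain j where j: "j \<le> b1" "w (x1, j) = 1" "\<And>k. j \<le> k \<Longrightarrow> k \<le> b1 \<Longrightarrow> up_ray w a1 k"
    using up_ray_source[OF assms(1) \<open>up_ray w a1 b1\<close>] 1 by metis
  obtain i where i: "i \<le> a2" "w (i, y2) = 1" "\<And>k. i \<le> k \<Longrightarrow> k \<le> a2 \<Longrightarrow> right_ray w k b2"
    using right_ray_source[OF assms(1) \<open>right_ray w a2 b2\<close>] 2 by metis
  consider "y2 \<le> j" | "x1 \<le> i" | "j \<le> b2" "i \<le> a1" using 1 2 by linarith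
  thus thesis
  proof cases
    case 1
    thus thesis using that[of x1 j] j \<open>y1 = Suc b1\<close> assms by simp
  next
    case 2
    thus thesis using that[of i y2] i \<open>x2 = Suc a2\<close> assms by simp
  next
    \<comment> \<open>If both sources lie outside the box, the two rays meet in
      \<open>(x1, y2)\<close>. But the upward ray continues beyond that cell, a
      contradiction.\<close>
    case 3
    have "up_ray w a1 b2" "right_ray w a1 b2" "up_ray w a1 (Suc b2)"
      using 3 1 2 assms i j by simp_all
    thus thesis
      using derived_ends_up_ray[OF assms(1)] derived_eq_1_iff(1)[OF assms(1)] by blast
  qed
qed

text \<open>One derived one is chosen between each pair of neighbours. The half-open bounds on the
  head make consecutive choices strictly SE of each other.\<close>

lemma derived_chain_of_chain:
  assumes "partial_perm w" "successively SE (c # d # cs)" "set (c # d # cs) \<subseteq> rect_ones w x y"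
  shows "\<exists>bs. length bs = Suc (length cs) \<and> successively SE bs \<and>
    set bs \<subseteq> rect_ones (derived w) x y \<and> fst c < fst (hd bs) \<and> snd (hd bs) \<le> snd c"
  using assms(2,3)
proof (induction cs arbitrary: c d)
  case Nil
  obtain i j where "fst c < i" "i \<le> fst d" "snd d < j" "j \<le> snd c" "derived w (i, j) = 1"
    using derived_between_ones[OF assms(1), of "fst c" "snd c" "fst d" "snd d"] Nil
    by (auto simp: rect_ones_def)
  thus ?case using Nil by (intro exI[of _ "[(i, j)]"]) (auto simp: rect_ones_def)
next
  case (Cons e cs)
  obtain i j where ij: "fst c < i" "i \<le> fst d" "snd d < j" "j \<le> snd c" "derived w (i, j) = 1"
    using derived_between_ones[OF assms(1), of "fst c" "snd c" "fst d" "snd d"] Cons.prems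
    by (auto simp: rect_ones_def)
  obtain bs where bs: "length bs = Suc (length cs)" "successively SE bs"
    "set bs \<subseteq> rect_ones (derived w) x y" "fst d < fst (hd bs)" "snd (hd bs) \<le> snd d"
    using Cons.IH[of d e] Cons.prems by auto
  show ?case
    using bs ij Cons.prems
    by (intro exI[of _ "(i, j) # bs"]) (auto simp: successively_Cons rect_ones_def)
qed

text \<open>Between neighbours \<open>one_between_derived\<close> supplies a one. The last derived
  cell contributes the source of its upward ray.\<close>

lemma chain_of_derived_chain:
  assumes "partial_perm w" "successively SE (b # bs)" "set (b # bs) \<subseteq> rect_ones (derived w) x y"
  shows "\<exists>cs. length cs = Suc (length bs) \<and> successively SE cs \<and>
    set cs \<subseteq> rect_ones w x y \<and> fst b \<le> fst (hd cs) \<and> snd (hd cs) < snd b"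
  using assms(2,3)
proof (induction bs arbitrary: b)
  case Nil
  then obtain i j where b: "b = (Suc i, Suc j)" "derived w (Suc i, Suc j) = 1" "Suc i \<le> x" "Suc j \<le> y"
    by (cases b) (auto simp: rect_ones_def gr0_conv_Suc)
  hence "up_ray w i j" using derived_eq_1_iff(1)[OF assms(1)] by blast
  then obtain j' where "0 < j'" "j' \<le> j" "w (Suc i, j') = 1"
    using up_ray_source[OF assms(1)] by blast
  thus ?case using b by (intro exI[of _ "[(Suc i, j')]"]) (auto simp: rect_ones_def)
next
  case (Cons d bs)
  obtain i j where ij: "fst b \<le> i" "i < fst d" "snd d \<le> j" "j < snd b" "w (i, j) = 1"
    using one_between_derived[OF assms(1), of "fst b" "snd b" "fst d" "snd d"] Cons.prems
    by (auto simp: rect_ones_def)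
  obtain cs where cs: "length cs = Suc (length bs)" "successively SE cs"
    "set cs \<subseteq> rect_ones w x y" "fst d \<le> fst (hd cs)" "snd (hd cs) < snd d"
    using Cons.IH[of d] Cons.prems by auto
  show ?case
    using cs ij Cons.prems
    by (intro exI[of _ "(i, j) # cs"]) (auto simp: successively_Cons rect_ones_def)
qed

lemma SE_chain_derived_iff:
  assumes "partial_perm w"
  shows "(\<exists>cs. length cs = Suc (Suc k) \<and> set cs \<subseteq> rect_ones w x y \<and> successively SE cs) \<longleftrightarrow>
    (\<exists>cs. length cs = Suc k \<and> set cs \<subseteq> rect_ones (derived w) x y \<and> successively SE cs)"
proof
  assume "\<exists>cs. length cs = Suc (Suc k) \<and> set cs \<subseteq> rect_ones w x y \<and> successively SE cs"
  then obtain es where es: "length es = Suc (Suc k)" "set es \<subseteq> rect_ones w x y" "successively SE es"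
    by blast
  then obtain c d cs where "es = c # d # cs" "length cs = k" by (auto simp: length_Suc_conv)
  with es have "length cs = k" "set (c # d # cs) \<subseteq> rect_ones w x y" "successively SE (c # d # cs)"
    by blast+
  thus "\<exists>cs. length cs = Suc k \<and> set cs \<subseteq> rect_ones (derived w) x y \<and> successively SE cs"
    using derived_chain_of_chain[OF assms, of c d cs x y] by blast
next
  assume "\<exists>cs. length cs = Suc k \<and> set cs \<subseteq> rect_ones (derived w) x y \<and> successively SE cs"
  then obtain es where es: "length es = Suc k" "set es \<subseteq> rect_ones (derived w) x y" "successively SE es"
    by blast
  then obtain b bs where "es = b # bs" "length bs = k" by (auto simp: length_Suc_conv)
  with es have bs: "length bs = k" "set (b # bs) \<subseteq> rect_ones (derived w) x y" "successively SE (b # bs)"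
    by blast+
  then obtain cs where cs: "length cs = Suc k" "successively SE cs"
    "set cs \<subseteq> rect_ones w x y" "fst b \<le> fst (hd cs)" "snd (hd cs) < snd b"
    using chain_of_derived_chain[OF assms, of b bs x y] by blast
  \<comment> \<open>The chain is still one cell short. The source of the rightward ray ending in
    \<open>b\<close> goes in front.\<close>
  obtain i j where b: "b = (Suc i, Suc j)" "derived w (Suc i, Suc j) = 1" "Suc i \<le> x" "Suc j \<le> y"
    using bs(2) by (cases b) (auto simp: rect_ones_def gr0_conv_Suc)
  hence "right_ray w i j" using derived_eq_1_iff(1)[OF assms(1)] by blast
  then obtain i' where "0 < i'" "i' \<le> i" "w (i', Suc j) = 1"
    using right_ray_source[OF assms(1)] by blast
  thus "\<exists>cs. length cs = Suc (Suc k) \<and> set cs \<subseteq> rect_ones w x y \<and> successively SE cs"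
    using cs b by (intro exI[of _ "(i', Suc j) # cs"]) (auto simp: successively_Cons rect_ones_def)
qed

text \<open>Induction over \<open>k\<close> for all fillings at once: deriving the filling deletes
  row 0 and shortens SE-chains by one. For \<open>k = 0\<close> a single cell is a chain of both
  kinds, so the first-row result applies.\<close>

theorem SE_chain_iff_growth:
  assumes "partial_perm w"
  shows "(\<exists>cs. length cs = Suc k \<and> set cs \<subseteq> rect_ones w x y \<and> successively SE cs) \<longleftrightarrow>
    0 < growth w x y k"
  using assms
proof (induction k arbitrary: w)
  case 0
  have "successively R cs" if "length cs = Suc 0" for R and cs :: "cell list"
    using that by (auto simp: length_Suc_conv)
  hence "(\<exists>cs. length cs = Suc 0 \<and> set cs \<subseteq> rect_ones w x y \<and> successively SE cs) \<longleftrightarrow>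
      (\<exists>cs. length cs = Suc 0 \<and> set cs \<subseteq> rect_ones w x y \<and> successively NE cs)"
    by blast
  thus ?case using NE_chain_iff_growth[OF 0, of "Suc 0" x y] by (simp only: Suc_le_eq)
next
  case (Suc k)
  have "growth w x y (Suc k) = growth (derived w) x y k"
    using fun_cong[OF growth_tail] .
  thus ?case
    using Suc.IH[OF partial_perm_derived[OF Suc.prems]] SE_chain_derived_iff[OF Suc.prems]
    by simp
qed

section \<open>Boundary data\<close>

definition down_closed :: "cell set \<Rightarrow> bool" where
  "down_closed F \<longleftrightarrow> finite F \<and> (\<forall>x y. (x, y) \<in> F \<longrightarrow> 0 < x \<and> 0 < y) \<and>
     (\<forall>x y x' y'. (x, y) \<in> F \<longrightarrow> 0 < x' \<longrightarrow> x' \<le> x \<longrightarrow> 0 < y' \<longrightarrow> y' \<le> y \<longrightarrow> (x', y') \<in> F)"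

text \<open>
  The point \<open>(x, y)\<close> is the north-east corner of the cell \<open>(x, y)\<close>, so the axes belong to the
  closure of every shape.
\<close>

definition boundary :: "cell set \<Rightarrow> cell set" where
  "boundary F = {(x, y). (x = 0 \<or> y = 0 \<or> (x, y) \<in> F) \<and> (Suc x, Suc y) \<notin> F}"

text \<open>A corner cell is indexed by its south-west lattice point, the point that joins the
  boundary when the cell is removed.\<close>

definition corner :: "cell set \<Rightarrow> nat \<Rightarrow> nat \<Rightarrow> bool" where
  "corner F a b \<longleftrightarrow>
     (Suc a, Suc b) \<in> F \<and> (Suc (Suc a), Suc b) \<notin> F \<and> (Suc a, Suc (Suc b)) \<notin> F"

lemma down_closedD:
  "down_closed F \<Longrightarrow> (x, y) \<in> F \<Longrightarrow> 0 < x' \<Longrightarrow> x' \<le> x \<Longrightarrow> 0 < y' \<Longrightarrow> y' \<le> y \<Longrightarrow> (x', y') \<in> F"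
  unfolding down_closed_def by blast

lemma down_closed_pos: "down_closed F \<Longrightarrow> (x, y) \<in> F \<Longrightarrow> 0 < x \<and> 0 < y"
  unfolding down_closed_def by blast

lemma down_closed_finite: "down_closed F \<Longrightarrow> finite F"
  unfolding down_closed_def by blast

text \<open>A cell maximising the sum of its coordinates is a corner.\<close>

lemma corner_exists:
  assumes "down_closed F" "F \<noteq> {}"
  obtains a b where "corner F a b"
proof -
  let ?S = "(\<lambda>c. fst c + snd c) ` F"
  have fin: "finite ?S" using assms by (simp add: down_closed_finite)
  hence "Max ?S \<in> ?S" using assms by (intro Max_in) auto
  then obtain x y where xy: "(x, y) \<in> F" "Max ?S = x + y" by auto
  have max: "x' + y' \<le> x + y" if "(x', y') \<in> F" for x' y'
    using Max_ge[OF fin, of "x' + y'"] that xy(2) by force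
  obtain a b where "x = Suc a" "y = Suc b"
    using down_closed_pos[OF assms(1) xy(1)] by (auto simp: gr0_conv_Suc)
  thus thesis using xy max[of "Suc x" y] max[of x "Suc y"] by (intro that) (auto simp: corner_def)
qed

lemma down_closed_remove_corner:
  assumes "down_closed F" "corner F a b"
  shows "down_closed (F - {(Suc a, Suc b)})"
proof -
  have "(Suc a, Suc b) \<noteq> (x', y')"
    if "(x, y) \<in> F" "(x, y) \<noteq> (Suc a, Suc b)" "x' \<le> x" "y' \<le> y" for x y x' y'
  proof
    assume eq: "(Suc a, Suc b) = (x', y')"
    hence "Suc (Suc a) \<le> x \<or> Suc (Suc b) \<le> y" using that by auto
    thus False
      using down_closedD[OF assms(1) that(1), of "Suc (Suc a)" "Suc b"]
        down_closedD[OF assms(1) that(1), of "Suc a" "Suc (Suc b)"] that eq assms(2)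
      by (auto simp: corner_def)
  qed
  hence "(x', y') \<in> F - {(Suc a, Suc b)}"
    if "(x, y) \<in> F - {(Suc a, Suc b)}" "0 < x'" "x' \<le> x" "0 < y'" "y' \<le> y" for x y x' y'
    using down_closedD[OF assms(1), of x y x' y'] that by blast
  thus ?thesis
    using down_closed_finite[OF assms(1)] down_closed_pos[OF assms(1)]
    unfolding down_closed_def by blast
qed

lemma boundary_remove_corner:
  assumes "down_closed F" "corner F a b"
  shows "boundary (F - {(Suc a, Suc b)}) = insert (a, b) (boundary F - {(Suc a, Suc b)})"
proof -
  have "a = 0 \<or> b = 0 \<or> (a, b) \<in> F"
    using down_closedD[OF assms(1), of "Suc a" "Suc b" a b] assms(2) by (auto simp: corner_def)
  thus ?thesis
    using assms(2) by (auto simp: boundary_def corner_def)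
qed

lemma corner_boundary:
  assumes "down_closed F" "corner F a b"
  shows "(Suc a, Suc b) \<in> boundary F" "(a, Suc b) \<in> boundary F" "(Suc a, b) \<in> boundary F"
    "(a, b) \<notin> boundary F"
  using assms(2) down_closedD[OF assms(1), of "Suc (Suc a)" "Suc (Suc b)" "Suc a" "Suc (Suc b)"]
    down_closedD[OF assms(1), of "Suc a" "Suc b" a "Suc b"]
    down_closedD[OF assms(1), of "Suc a" "Suc b" "Suc a" b]
  by (auto simp: boundary_def corner_def)

text \<open>The rectangles below all other boundary points miss the corner cell, so by
  \<open>growth_upd_outside\<close> its entry does not affect their partitions.\<close>

lemma boundary_not_beyond_corner:
  assumes "down_closed F" "corner F a b" "(x, y) \<in> boundary F" "(x, y) \<noteq> (Suc a, Suc b)"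
  shows "x \<le> a \<or> y \<le> b"
proof (rule ccontr)
  assume n: "\<not> ?thesis"
  hence F: "(x, y) \<in> F" using assms(3) by (auto simp: boundary_def)
  have "Suc (Suc a) \<le> x \<or> Suc (Suc b) \<le> y" using n assms(4) by auto
  thus False
    using down_closedD[OF assms(1) F, of "Suc (Suc a)" "Suc b"]
      down_closedD[OF assms(1) F, of "Suc a" "Suc (Suc b)"] n assms(2)
    by (auto simp: corner_def)
qed

lemma growth_upd_outside:
  assumes "x \<le> a \<or> y \<le> b"
  shows "growth (w((Suc a, Suc b) := z)) x y = growth w x y"
  by (rule growth_cong) (use assms in auto)

text \<open>Corners are peeled off one at a time: the backward rule recovers the entry and the
  partition at the newly exposed boundary point.\<close>

theorem growth_boundary_unique:
  assumes "down_closed F" "\<And>c. c \<notin> F \<Longrightarrow> w c = 0" "\<And>c. c \<notin> F \<Longrightarrow> w' c = 0"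
    and "\<And>x y. (x, y) \<in> boundary F \<Longrightarrow> growth w x y = growth w' x y"
  shows "w = w'"
  using assms
proof (induction "card F" arbitrary: F w w' rule: less_induct)
  case less
  show ?case
  proof (cases "F = {}")
    case True
    thus ?thesis using less.prems by auto
  next
    case False
    then obtain a b where ab: "corner F a b" using corner_exists less.prems(1) by blast
    let ?c = "(Suc a, Suc b)"
    note bd = corner_boundary[OF less.prems(1) ab]
    have "grow (w ?c) (growth w a b) (growth w a (Suc b)) (growth w (Suc a) b) =
        grow (w' ?c) (growth w' a b) (growth w a (Suc b)) (growth w (Suc a) b)"
      using less.prems(4)[OF bd(1)] less.prems(4)[OF bd(2)] less.prems(4)[OF bd(3)] by simp
    moreover have "growth w a b i \<le> growth w a (Suc b) i" "growth w a b i \<le> growth w (Suc a) b i"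
      "growth w' a b i \<le> growth w a (Suc b) i" "growth w' a b i \<le> growth w (Suc a) b i" for i
      using growth_mono_Suc_left[of _ a b i] growth_mono_Suc_right[of _ a b i]
        less.prems(4)[OF bd(2)] less.prems(4)[OF bd(3)] by metis+
    ultimately have eq: "w ?c = w' ?c" "growth w a b = growth w' a b"
      using grow_inverse_unique by blast+
    \<comment> \<open>Clearing the corner entry gives fillings supported on the smaller shape, so
      the induction hypothesis applies.\<close>
    have "w(?c := 0) = w'(?c := 0)"
    proof (rule less.hyps[of "F - {?c}"])
      show "card (F - {?c}) < card F"
        using ab less.prems(1) by (intro card_Diff1_less) (auto simp: corner_def down_closed_finite)
      show "down_closed (F - {?c})" by (rule down_closed_remove_corner[OF less.prems(1) ab])
      fix x y assume "(x, y) \<in> boundary (F - {?c})"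
      hence "(x, y) = (a, b) \<or> (x, y) \<in> boundary F \<and> (x, y) \<noteq> ?c"
        unfolding boundary_remove_corner[OF less.prems(1) ab] by blast
      hence "x \<le> a \<or> y \<le> b" "growth w x y = growth w' x y"
        using boundary_not_beyond_corner[OF less.prems(1) ab] less.prems(4) eq(2) by blast+
      thus "growth (w(?c := 0)) x y = growth (w'(?c := 0)) x y"
        by (simp add: growth_upd_outside)
    qed (use less.prems(2,3) in auto)
    thus ?thesis using eq(1) by (metis fun_upd_triv fun_upd_upd)
  qed
qed

section \<open>Fillings with prescribed boundary partitions\<close>

definition boundary_data :: "cell set \<Rightarrow> (nat \<Rightarrow> nat \<Rightarrow> nat \<Rightarrow> nat) \<Rightarrow> bool" where
  "boundary_data F L \<longleftrightarrow>
     (\<forall>x y. (x, y) \<in> boundary F \<longrightarrow> is_partition (L x y)) \<and>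
     (\<forall>x y. (x, y) \<in> boundary F \<longrightarrow> x = 0 \<or> y = 0 \<longrightarrow> L x y = (\<lambda>_. 0)) \<and>
     (\<forall>x y. (x, y) \<in> boundary F \<longrightarrow> (Suc x, y) \<in> boundary F \<longrightarrow> step (L x y) (L (Suc x) y)) \<and>
     (\<forall>x y. (x, y) \<in> boundary F \<longrightarrow> (x, Suc y) \<in> boundary F \<longrightarrow> step (L x y) (L x (Suc y)))"

lemma boundary_data_remove_corner:
  assumes F: "down_closed F" "corner F a b" and L: "boundary_data F L"
    and \<rho>: "is_partition \<rho>" "step \<rho> (L a (Suc b))" "step \<rho> (L (Suc a) b)"
  shows "boundary_data (F - {(Suc a, Suc b)}) (\<lambda>x y. if (x, y) = (a, b) then \<rho> else L x y)"
    (is "boundary_data ?F ?L")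
proof -
  note bd = corner_boundary[OF F]
  have bF: "(x, y) \<in> boundary ?F \<longleftrightarrow> (x, y) = (a, b) \<or> (x, y) \<in> boundary F \<and> (x, y) \<noteq> (Suc a, Suc b)"
    for x y unfolding boundary_remove_corner[OF F] by blast
  \<comment> \<open>The left and lower neighbours of the new point are not on the boundary, so only
    the two edges leaving it have to be checked.\<close>
  have left: "(x, b) \<notin> boundary ?F" if "a = Suc x" for x
    using down_closedD[OF F(1), of "Suc a" "Suc b" a "Suc b"] F(2) that
    by (auto simp: boundary_def corner_def)
  have below: "(a, y) \<notin> boundary ?F" if "b = Suc y" for y
    using down_closedD[OF F(1), of "Suc a" "Suc b" "Suc a" b] F(2) that
    by (auto simp: boundary_def corner_def)
  \<comment> \<open>If the new point lies on an axis, so does one of its two neighbours, and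
    \<open>\<rho>\<close> is contained in the empty partition there.\<close>
  have zero: "\<rho> = (\<lambda>_. 0)" if "a = 0 \<or> b = 0"
  proof -
    have "L a (Suc b) = (\<lambda>_. 0) \<or> L (Suc a) b = (\<lambda>_. 0)"
      using L bd that unfolding boundary_data_def by blast
    thus ?thesis using step_le[OF \<rho>(2)] step_le[OF \<rho>(3)] by (auto simp: fun_eq_iff)
  qed
  show ?thesis
    unfolding boundary_data_def
  proof (intro conjI allI impI)
    fix x y assume "(x, y) \<in> boundary ?F"
    thus "is_partition (?L x y)" using \<rho>(1) L unfolding bF boundary_data_def by auto
  next
    fix x y assume "(x, y) \<in> boundary ?F" "x = 0 \<or> y = 0"
    thus "?L x y = (\<lambda>_. 0)" using zero L unfolding bF boundary_data_def by auto
  next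
    fix x y assume xy: "(x, y) \<in> boundary ?F" "(Suc x, y) \<in> boundary ?F"
    hence "(Suc x, y) \<noteq> (a, b)" using left by auto
    thus "step (?L x y) (?L (Suc x) y)" using xy \<rho>(3) L unfolding bF boundary_data_def by auto
  next
    fix x y assume xy: "(x, y) \<in> boundary ?F" "(x, Suc y) \<in> boundary ?F"
    hence "(x, Suc y) \<noteq> (a, b)" using below by auto
    thus "step (?L x y) (?L x (Suc y))" using xy \<rho>(2) L unfolding bF boundary_data_def by auto
  qed
qed

lemma partial_perm_upd_corner:
  assumes "partial_perm w" "z \<le> 1"
    and "z = 1 \<Longrightarrow> (\<forall>y. w (Suc a, y) = 0) \<and> (\<forall>x. w (x, Suc b) = 0)"
  shows "partial_perm (w((Suc a, Suc b) := z))"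
  unfolding partial_perm_def
proof (intro conjI allI impI)
  show "(w((Suc a, Suc b) := z)) c \<le> 1" for c
    using assms(2) partial_perm_le_1[OF assms(1), of c] by simp
  show "(w((Suc a, Suc b) := z)) (x, 0) = 0" "(w((Suc a, Suc b) := z)) (0, x) = 0" for x
    using partial_perm_axes[OF assms(1)] by simp_all
next
  fix x y y' assume "(w((Suc a, Suc b) := z)) (x, y) = 1" "(w((Suc a, Suc b) := z)) (x, y') = 1"
  thus "y = y'" using assms(3) partial_perm_column[OF assms(1), of x y y']
    by (auto split: if_splits)
next
  fix x x' y assume "(w((Suc a, Suc b) := z)) (x, y) = 1" "(w((Suc a, Suc b) := z)) (x', y) = 1"
  thus "x = x'" using assms(3) partial_perm_row[OF assms(1), of x y x']
    by (auto split: if_splits)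
qed

text \<open>The backward rule at a corner gives the entry and boundary data for the smaller shape.
  For the empty shape the boundary consists of the axes and the zero filling works.\<close>

theorem growth_boundary_exists:
  assumes "down_closed F" "boundary_data F L"
  shows "\<exists>w. partial_perm w \<and> (\<forall>c. c \<notin> F \<longrightarrow> w c = 0) \<and>
    (\<forall>x y. (x, y) \<in> boundary F \<longrightarrow> growth w x y = L x y)"
  using assms
proof (induction "card F" arbitrary: F L rule: less_induct)
  case less
  show ?case
  proof (cases "F = {}")
    case True
    hence "growth (\<lambda>_. 0) x y = L x y" if "(x, y) \<in> boundary F" for x y
      using that less.prems(2) unfolding boundary_data_def by (auto simp: boundary_def)
    thus ?thesis by (intro exI[of _ "\<lambda>_. 0"]) (auto simp: partial_perm_def)
  next
    case False
    then obtain a b where ab: "corner F a b" using corner_exists less.prems(1) by blast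
    let ?c = "(Suc a, Suc b)"
    note bd = corner_boundary[OF less.prems(1) ab]
    have "is_partition (L (Suc a) (Suc b))" "is_partition (L a (Suc b))" "is_partition (L (Suc a) b)"
      "step (L a (Suc b)) (L (Suc a) (Suc b))" "step (L (Suc a) b) (L (Suc a) (Suc b))"
      using less.prems(2) bd unfolding boundary_data_def by blast+
    then obtain \<rho> z where \<rho>: "is_partition \<rho>" "step \<rho> (L a (Suc b))" "step \<rho> (L (Suc a) b)"
      and z: "z \<le> 1" "z = 1 \<Longrightarrow> L a (Suc b) = \<rho> \<and> L (Suc a) b = \<rho>"
      and gr: "L (Suc a) (Suc b) = grow z \<rho> (L a (Suc b)) (L (Suc a) b)"
      using grow_inverse_exists by metis
    let ?L = "\<lambda>x y. if (x, y) = (a, b) then \<rho> else L x y"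
    have "card (F - {?c}) < card F"
      using ab less.prems(1) by (intro card_Diff1_less) (auto simp: corner_def down_closed_finite)
    then obtain v where v: "partial_perm v" "\<forall>c. c \<notin> F - {?c} \<longrightarrow> v c = 0"
      and gv: "\<And>x y. (x, y) \<in> boundary (F - {?c}) \<Longrightarrow> growth v x y = ?L x y"
      using less.hyps[OF _ down_closed_remove_corner[OF less.prems(1) ab]
          boundary_data_remove_corner[OF less.prems(1) ab less.prems(2) \<rho>]] by blast
    let ?w = "v(?c := z)"
    have gw: "growth ?w x y = L x y" if "(x, y) \<in> boundary F" "(x, y) \<noteq> ?c" for x y
    proof -
      have "(x, y) \<noteq> (a, b)" using that bd by blast
      thus ?thesis
        using gv[of x y] that boundary_not_beyond_corner[OF less.prems(1) ab that]
        unfolding boundary_remove_corner[OF less.prems(1) ab] by (auto simp: growth_upd_outside)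
    qed
    have gab: "growth ?w a b = \<rho>"
      using gv[of a b] unfolding boundary_remove_corner[OF less.prems(1) ab]
      by (simp add: growth_upd_outside)
    have "growth ?w (Suc a) (Suc b) = L (Suc a) (Suc b)"
      unfolding growth.simps(3) gab gr using gw[OF bd(2)] gw[OF bd(3)] by simp
    moreover have "partial_perm ?w"
    proof (rule partial_perm_upd_corner[OF v(1) z(1)])
      \<comment> \<open>An entry 1 comes with equal partitions along both edges, so
        \<open>growth_column_empty_iff\<close> and its row version leave no other one in the
        corner's column and row.\<close>
      assume "z = 1"
      hence "growth ?w (Suc a) b = growth ?w a b" "growth ?w a (Suc b) = growth ?w a b"
        using z(2) gab gw[OF bd(2)] gw[OF bd(3)] by simp_all
      hence empty: "0 < j \<Longrightarrow> j \<le> b \<Longrightarrow> v (Suc a, j) = 0" "0 < i \<Longrightarrow> i \<le> a \<Longrightarrow> v (i, Suc b) = 0" for i j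
        unfolding growth_column_empty_iff growth_row_empty_iff by (auto split: if_splits)
      have "v (Suc a, j) = 0" for j
      proof (cases "0 < j \<and> j \<le> b")
        case False
        hence "j = 0 \<or> j = Suc b \<or> Suc (Suc b) \<le> j" by linarith
        hence "(Suc a, j) \<notin> F - {?c}"
          using ab down_closed_pos[OF less.prems(1), of "Suc a" j]
            down_closedD[OF less.prems(1), of "Suc a" j "Suc a" "Suc (Suc b)"]
          by (auto simp: corner_def)
        thus ?thesis by (rule v(2)[rule_format])
      qed (use empty in blast)
      moreover have "v (i, Suc b) = 0" for i
      proof (cases "0 < i \<and> i \<le> a")
        case False
        hence "i = 0 \<or> i = Suc a \<or> Suc (Suc a) \<le> i" by linarith
        hence "(i, Suc b) \<notin> F - {?c}"
          using ab down_closed_pos[OF less.prems(1), of i "Suc b"]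
            down_closedD[OF less.prems(1), of i "Suc b" "Suc (Suc a)" "Suc b"]
          by (auto simp: corner_def)
        thus ?thesis by (rule v(2)[rule_format])
      qed (use empty in blast)
      ultimately show "(\<forall>y. v (Suc a, y) = 0) \<and> (\<forall>x. v (x, Suc b) = 0)" by blast
    qed
    moreover have "?w c = 0" if "c \<notin> F" for c
      using that v(2)[rule_format, of c] ab by (auto simp: corner_def)
    ultimately show ?thesis using gw by (intro exI[of _ ?w]) blast
  qed
qed

lemma boundary_data_conjugate:
  assumes "partial_perm w"
  shows "boundary_data F (\<lambda>x y. conjugate (growth w x y))"
proof -
  have "x = 0 \<or> y = 0 \<Longrightarrow> conjugate (growth w x y) = (\<lambda>_. 0)" for x y
    by (auto simp: conjugate_zero)
  thus ?thesis
    unfolding boundary_data_def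
    using partition_growth[OF assms] growth_step[OF assms] step_conjugate partition_conjugate
    by metis
qed

section \<open>Fillings\<close>

text \<open>Members of \<open>fillings F\<close> are \<open>undefined\<close> outside
  \<open>F\<close>, while growth diagrams need zeros there.\<close>

definition extend :: "cell set \<Rightarrow> (cell \<Rightarrow> nat) \<Rightarrow> cell \<Rightarrow> nat" where
  "extend F f c = (if c \<in> F then f c else 0)"

lemma ones_extend: "ones F f = {c. extend F f c = 1}"
  by (auto simp: ones_def extend_def)

lemma at_most_one_per_line_iff:
  assumes "down_closed F" "f \<in> fillings F"
  shows "at_most_one_per_line F f \<longleftrightarrow> partial_perm (extend F f)"
proof -
  let ?w = "extend F f"
  have fin: "finite {c \<in> ones F f. P c}" for P
    using down_closed_finite[OF assms(1)] by (auto simp: ones_def)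
  have "?w c \<le> 1" for c
    using PiE_mem[OF assms(2)[unfolded fillings_def], of c] by (auto simp: extend_def)
  moreover have "?w (x, 0) = 0" "?w (0, x) = 0" for x
    using down_closed_pos[OF assms(1)] by (auto simp: extend_def)
  moreover have "(\<forall>j. card {c \<in> ones F f. fst c = j} \<le> 1) \<longleftrightarrow>
      (\<forall>x y y'. ?w (x, y) = 1 \<longrightarrow> ?w (x, y') = 1 \<longrightarrow> y = y')"
    unfolding One_nat_def card_le_Suc0_iff_eq[OF fin] by (fastforce simp: ones_extend)
  moreover have "(\<forall>i. card {c \<in> ones F f. snd c = i} \<le> 1) \<longleftrightarrow>
      (\<forall>x x' y. ?w (x, y) = 1 \<longrightarrow> ?w (x', y) = 1 \<longrightarrow> x = x')"
    unfolding One_nat_def card_le_Suc0_iff_eq[OF fin] by (fastforce simp: ones_extend)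
  ultimately show ?thesis
    unfolding at_most_one_per_line_def partial_perm_def by blast
qed

text \<open>Go up the diagonal from the cell until the next step would leave the shape.\<close>

lemma boundary_above:
  assumes "down_closed F" "(x, y) \<in> F"
  obtains x' y' where "(x', y') \<in> boundary F" "x \<le> x'" "y \<le> y'"
proof -
  let ?D = "(\<lambda>d. (x + d, y + d)) -` F"
  have fin: "finite ?D"
    using down_closed_finite[OF assms(1)] by (intro finite_vimageI) (auto simp: inj_def)
  have "0 \<in> ?D" using assms(2) by simp
  hence "Max ?D \<in> ?D" using fin by (intro Max_in) blast+
  moreover have "Suc (Max ?D) \<notin> ?D" using Max_ge[OF fin] by fastforce
  ultimately show thesis by (intro that[of "x + Max ?D" "y + Max ?D"]) (auto simp: boundary_def)
qed

lemma chain_bounds: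
  assumes "successively NE cs \<or> successively SE cs" "c \<in> set cs"
  shows "fst c \<le> fst (last cs)"
    and "successively NE cs \<Longrightarrow> snd c \<le> snd (last cs)"
    and "successively SE cs \<Longrightarrow> snd c \<le> snd (hd cs)"
proof -
  have tr: "transp NE" "transp SE" by (auto simp: transp_def)
  show "fst c \<le> fst (last cs)"
    using assms successively_conv_sorted_wrt[OF tr(1), of cs] successively_conv_sorted_wrt[OF tr(2), of cs]
    by (cases cs rule: rev_cases) (auto simp: sorted_wrt_append less_imp_le)
  show "snd c \<le> snd (last cs)" if "successively NE cs"
    using that assms(2) successively_conv_sorted_wrt[OF tr(1), of cs]
    by (cases cs rule: rev_cases) (auto simp: sorted_wrt_append less_imp_le)
  show "snd c \<le> snd (hd cs)" if "successively SE cs"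
    using that assms(2) successively_conv_sorted_wrt[OF tr(2), of cs]
    by (cases cs) (auto simp: less_imp_le)
qed

lemma rect_ones_extend_subset: "rect_ones (extend F f) x y \<subseteq> ones F f"
  by (auto simp: rect_ones_def ones_extend)

lemma NE_chain_length_iff:
  assumes F: "down_closed F" and w: "partial_perm (extend F f)"
  shows "(\<exists>cs. length cs = Suc k \<and> NE_chain F f cs) \<longleftrightarrow>
    (\<exists>x y. (x, y) \<in> boundary F \<and> k < growth (extend F f) x y 0)"
proof
  assume "\<exists>cs. length cs = Suc k \<and> NE_chain F f cs"
  then obtain cs where cs: "length cs = Suc k" "set cs \<subseteq> ones F f" "successively NE cs"
    by (auto simp: NE_chain_def)
  hence "last cs \<in> F" by (cases cs rule: rev_cases) (auto simp: ones_def)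
  then obtain x y where xy: "(x, y) \<in> boundary F" "fst (last cs) \<le> x" "snd (last cs) \<le> y"
    using boundary_above[OF F, of "fst (last cs)" "snd (last cs)"] by auto
  have "set cs \<subseteq> rect_ones (extend F f) x y"
  proof
    fix c assume c: "c \<in> set cs"
    hence "c \<in> F" "extend F f c = 1" using cs(2) by (auto simp: ones_def extend_def)
    thus "c \<in> rect_ones (extend F f) x y"
      using xy chain_bounds[of cs c] cs(3) c down_closed_pos[OF F, of "fst c" "snd c"]
      by (cases c) (auto simp: rect_ones_def)
  qed
  hence "Suc k \<le> growth (extend F f) x y 0"
    using NE_chain_iff_growth[OF w] cs by blast
  thus "\<exists>x y. (x, y) \<in> boundary F \<and> k < growth (extend F f) x y 0"
    using xy(1) Suc_le_lessD by blast
next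
  assume "\<exists>x y. (x, y) \<in> boundary F \<and> k < growth (extend F f) x y 0"
  then obtain x y where "Suc k \<le> growth (extend F f) x y 0" using Suc_leI by blast
  then obtain cs where cs: "length cs = Suc k" "set cs \<subseteq> rect_ones (extend F f) x y" "successively NE cs"
    using NE_chain_iff_growth[OF w] by blast
  thus "\<exists>cs. length cs = Suc k \<and> NE_chain F f cs"
    using rect_ones_extend_subset unfolding NE_chain_def by blast
qed

lemma SE_chain_length_iff:
  assumes F: "down_closed F" and w: "partial_perm (extend F f)"
  shows "(\<exists>cs. length cs = Suc k \<and> SE_chain F f cs \<and> enclosing_rectangle cs \<subseteq> F) \<longleftrightarrow>
    (\<exists>x y. (x, y) \<in> boundary F \<and> 0 < growth (extend F f) x y k)"
proof
  assume "\<exists>cs. length cs = Suc k \<and> SE_chain F f cs \<and> enclosing_rectangle cs \<subseteq> F"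
  then obtain cs where cs: "length cs = Suc k" "set cs \<subseteq> ones F f" "successively SE cs"
    and enc: "enclosing_rectangle cs \<subseteq> F"
    by (auto simp: SE_chain_def)
  \<comment> \<open>This is the north-east corner of the enclosing rectangle. That it lies in
    \<open>F\<close> gives a boundary point whose rectangle contains the whole chain.\<close>
  have "(fst (last cs), snd (hd cs)) \<in> enclosing_rectangle cs"
    using cs(1) by (auto simp: enclosing_rectangle_def)
  then obtain x y where xy: "(x, y) \<in> boundary F" "fst (last cs) \<le> x" "snd (hd cs) \<le> y"
    using boundary_above[OF F] enc by blast
  have "set cs \<subseteq> rect_ones (extend F f) x y"
  proof
    fix c assume c: "c \<in> set cs"
    hence "c \<in> F" "extend F f c = 1" using cs(2) by (auto simp: ones_def extend_def)
    thus "c \<in> rect_ones (extend F f) x y"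
      using xy chain_bounds[of cs c] cs(3) c down_closed_pos[OF F, of "fst c" "snd c"]
      by (cases c) (auto simp: rect_ones_def)
  qed
  hence "0 < growth (extend F f) x y k"
    using SE_chain_iff_growth[OF w] cs by blast
  thus "\<exists>x y. (x, y) \<in> boundary F \<and> 0 < growth (extend F f) x y k"
    using xy by auto
next
  assume "\<exists>x y. (x, y) \<in> boundary F \<and> 0 < growth (extend F f) x y k"
  then obtain x y where xy: "(x, y) \<in> boundary F" "0 < growth (extend F f) x y k" by auto
  then obtain cs where cs: "length cs = Suc k" "set cs \<subseteq> rect_ones (extend F f) x y" "successively SE cs"
    using SE_chain_iff_growth[OF w] by blast
  have ne: "cs \<noteq> []" using cs(1) by auto
  hence mem: "hd cs \<in> rect_ones (extend F f) x y" "last cs \<in> rect_ones (extend F f) x y"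
    using cs(2) by auto
  \<comment> \<open>A nonempty chain keeps the boundary point off the axes. The point is thus a cell
    of \<open>F\<close>, and everything below it lies in \<open>F\<close>.\<close>
  hence "0 < x" "0 < y" by (auto simp: rect_ones_def)
  hence "(x, y) \<in> F" using xy(1) by (simp add: boundary_def)
  have "enclosing_rectangle cs \<subseteq> F"
  proof
    fix c assume "c \<in> enclosing_rectangle cs"
    hence "0 < fst c" "fst c \<le> x" "0 < snd c" "snd c \<le> y"
      using mem ne by (auto simp: enclosing_rectangle_def rect_ones_def)
    thus "c \<in> F" using down_closedD[OF F \<open>(x, y) \<in> F\<close>, of "fst c" "snd c"] by simp
  qed
  thus "\<exists>cs. length cs = Suc k \<and> SE_chain F f cs \<and> enclosing_rectangle cs \<subseteq> F"
    using cs rect_ones_extend_subset unfolding SE_chain_def by blast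
qed

text \<open>Positive lengths suffice because the empty list is a chain of both kinds with empty
  rectangle.\<close>

lemma longest_NE_eq_longest_SE:
  assumes "\<And>k. (\<exists>cs. length cs = Suc k \<and> NE_chain F g cs) \<longleftrightarrow>
    (\<exists>cs. length cs = Suc k \<and> SE_chain F f cs \<and> enclosing_rectangle cs \<subseteq> F)"
  shows "longest_NE F g = longest_SE F f"
proof -
  have "(\<exists>cs. length cs = k \<and> NE_chain F g cs) \<longleftrightarrow>
      (\<exists>cs. length cs = k \<and> SE_chain F f cs \<and> enclosing_rectangle cs \<subseteq> F)" for k
    using assms by (cases k) (auto simp: NE_chain_def SE_chain_def enclosing_rectangle_def)
  hence "{length cs | cs. NE_chain F g cs} =
      {length cs | cs. SE_chain F f cs \<and> enclosing_rectangle cs \<subseteq> F}" by (intro Collect_cong) metis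
  thus ?thesis by (simp add: longest_NE_def longest_SE_def)
qed

text \<open>The right-hand side refers only to inequality of neighbouring boundary partitions, which
  conjugation preserves. With \<open>card_ones\<close> this keeps the number of ones.\<close>

lemma nonempty_columns:
  assumes F: "down_closed F" and w: "partial_perm (extend F f)"
  shows "fst ` ones F f = {Suc x | x. \<exists>y. (x, y) \<in> boundary F \<and> (Suc x, y) \<in> boundary F \<and>
    growth (extend F f) (Suc x) y \<noteq> growth (extend F f) x y}" (is "_ = ?C")
proof (intro equalityI subsetI)
  fix x' assume "x' \<in> fst ` ones F f"
  then obtain j where j: "(x', j) \<in> F" "extend F f (x', j) = 1" by (auto simp: ones_def extend_def)
  obtain x where x: "x' = Suc x" using down_closed_pos[OF F j(1)] by (auto simp: gr0_conv_Suc)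
  let ?D = "(\<lambda>y. (Suc x, y)) -` F"
  have fin: "finite ?D"
    using down_closed_finite[OF F] by (intro finite_vimageI) (auto simp: inj_def)
  \<comment> \<open>At the top of the column both ends of the edge are boundary points and every
    cell of the column lies below.\<close>
  define y where "y = Max ?D"
  have "y \<in> ?D" unfolding y_def using j(1) x fin by (intro Max_in) auto
  hence y: "(Suc x, y) \<in> F" by simp
  have ny: "(Suc x, Suc y) \<notin> F" using Max_ge[OF fin, of "Suc y"] by (auto simp: y_def[symmetric])
  have "(x, y) \<in> boundary F" "(Suc x, y) \<in> boundary F"
    using y ny down_closedD[OF F y, of x y] down_closed_pos[OF F y]
      down_closedD[OF F, of "Suc (Suc x)" "Suc y" "Suc x" "Suc y"]
    by (auto simp: boundary_def)
  moreover have "j \<le> y" using Max_ge[OF fin, of j] j(1) x by (simp add: y_def)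
  hence "growth (extend F f) (Suc x) y \<noteq> growth (extend F f) x y"
    unfolding growth_column_empty_iff using j x down_closed_pos[OF F j(1)] by auto
  ultimately show "x' \<in> ?C" using x by blast
next
  fix x' assume "x' \<in> ?C"
  then obtain x j where "x' = Suc x" "extend F f (Suc x, j) \<noteq> 0"
    unfolding growth_column_empty_iff by blast
  moreover from this have "(Suc x, j) \<in> ones F f"
    using partial_perm_eq_0_iff[OF w, of "(Suc x, j)"] by (simp add: ones_extend)
  ultimately show "x' \<in> fst ` ones F f" by (metis fst_conv image_eqI)
qed

lemma card_ones:
  assumes "partial_perm (extend F f)"
  shows "card (ones F f) = card (fst ` ones F f)"
proof (rule card_image[symmetric], rule inj_onI)
  fix c d assume "c \<in> ones F f" "d \<in> ones F f" "fst c = fst d"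
  thus "c = d"
    using partial_perm_column[OF assms, of "fst c" "snd c" "snd d"]
    by (cases c; cases d) (auto simp: ones_extend)
qed

text \<open>By \<open>less_conjugate_iff\<close>, conjugation exchanges the length of row 0 with the
  number of nonempty rows. The boundary equation is kept in the conclusion for the injectivity
  argument.\<close>

theorem conjugate_filling:
  assumes F: "down_closed F" and f: "f \<in> fillings F" "at_most_one_per_line F f"
  shows "\<exists>g \<in> fillings F. at_most_one_per_line F g \<and> card (ones F g) = card (ones F f) \<and>
    longest_NE F g = longest_SE F f \<and> longest_SE F g = longest_NE F f \<and>
    (\<forall>x y. (x, y) \<in> boundary F \<longrightarrow> growth (extend F g) x y = conjugate (growth (extend F f) x y))"
proof -
  have w: "partial_perm (extend F f)" using at_most_one_per_line_iff[OF F f(1)] f(2) by blast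
  obtain v where v: "partial_perm v" "\<And>c. c \<notin> F \<Longrightarrow> v c = 0"
    "\<And>x y. (x, y) \<in> boundary F \<Longrightarrow> growth v x y = conjugate (growth (extend F f) x y)"
    using growth_boundary_exists[OF F boundary_data_conjugate[OF w]] by blast
  let ?g = "restrict v F"
  have ext: "extend F ?g = v" using v(2) by (auto simp: extend_def)
  have g: "?g \<in> fillings F"
    using partial_perm_eq_0_iff[OF v(1)] by (auto simp: fillings_def)
  note part = partition_growth[OF w]
  have "longest_NE F ?g = longest_SE F f"
    by (rule longest_NE_eq_longest_SE, unfold NE_chain_length_iff[OF F, of ?g, unfolded ext, OF v(1)]
        SE_chain_length_iff[OF F w]) (metis v(3) less_conjugate_iff[OF part])
  moreover have "longest_NE F f = longest_SE F ?g"
    by (rule longest_NE_eq_longest_SE, unfold NE_chain_length_iff[OF F w]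
        SE_chain_length_iff[OF F, of ?g, unfolded ext, OF v(1)]) (metis v(3) less_conjugate_iff[OF part])
  moreover have "fst ` ones F ?g = fst ` ones F f"
    unfolding nonempty_columns[OF F w] nonempty_columns[OF F, of ?g, unfolded ext, OF v(1)]
    using v(3) conjugate_inject[OF part part] by (metis (lifting))
  hence "card (ones F ?g) = card (ones F f)"
    using card_ones[OF w] card_ones[of F ?g, unfolded ext, OF v(1)] by simp
  ultimately show ?thesis
    using g at_most_one_per_line_iff[OF F g] v ext by (intro bexI[of _ ?g]) auto
qed

text \<open>The choice of a conjugate filling is injective: its boundary partitions determine those
  of the original, hence the original. The reverse inequality arises by exchanging \<open>s\<close>
  and \<open>t\<close>.\<close>

lemma num_fillings_le:
  assumes F: "down_closed F"
  shows "num_fillings F n s t \<le> num_fillings F n t s"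
proof -
  define A where "A s t = {f \<in> fillings F. card (ones F f) = n \<and> at_most_one_per_line F f \<and>
             longest_NE F f = s \<and> longest_SE F f = t}" for s t
  have A: "f \<in> fillings F" "partial_perm (extend F f)" if "f \<in> A s t" for f
    using that at_most_one_per_line_iff[OF F] by (auto simp: A_def)
  have "\<exists>g \<in> A t s. \<forall>x y. (x, y) \<in> boundary F \<longrightarrow>
      growth (extend F g) x y = conjugate (growth (extend F f) x y)" if "f \<in> A s t" for f
    using conjugate_filling[OF F, of f] that by (auto simp: A_def)
  then obtain T where T: "\<And>f. f \<in> A s t \<Longrightarrow> T f \<in> A t s"
    "\<And>f x y. f \<in> A s t \<Longrightarrow> (x, y) \<in> boundary F \<Longrightarrow>
      growth (extend F (T f)) x y = conjugate (growth (extend F f) x y)"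
    by metis
  have "inj_on T (A s t)"
  proof (rule inj_onI)
    fix f g assume f: "f \<in> A s t" and g: "g \<in> A s t" and eq: "T f = T g"
    have "growth (extend F f) x y = growth (extend F g) x y" if "(x, y) \<in> boundary F" for x y
      using T(2)[OF f that] T(2)[OF g that] eq
        conjugate_inject[OF partition_growth[OF A(2)[OF f]] partition_growth[OF A(2)[OF g]], of x y x y]
      by simp
    hence "extend F f = extend F g"
      by (intro growth_boundary_unique[OF F]) (auto simp: extend_def)
    hence "f c = g c" if "c \<in> F" for c using that by (metis extend_def)
    thus "f = g" using A(1)[OF f] A(1)[OF g] unfolding fillings_def by (blast intro: PiE_ext)
  qed
  moreover have "finite (fillings F)"
    unfolding fillings_def using down_closed_finite[OF F] by (intro finite_PiE) auto
  hence "finite (A t s)" by (simp add: A_def)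
  ultimately have "card (A s t) \<le> card (A t s)"
    using T(1) by (intro card_inj_on_le[of T]) auto
  thus ?thesis by (simp add: num_fillings_def A_def)
qed

section \<open>Ferrers shapes as down-closed sets\<close>

lemma ferrers_shape_down_closed:
  assumes "ferrers_shape F"
  shows "down_closed F"
proof -
  obtain hs where hs: "sorted_wrt (\<ge>) hs" "F = ferrers_cells hs"
    using assms by (auto simp: ferrers_shape_def)
  have mono: "hs ! j \<le> hs ! i" if "i \<le> j" "j < length hs" for i j
    using sorted_wrt_nth_less[OF hs(1), of i j] that by (cases "i = j") auto
  have "F \<subseteq> {..length hs} \<times> {..Max (set hs)}"
  proof
    fix c assume "c \<in> F"
    then obtain j i where c: "c = (j, i)" "1 \<le> j" "j \<le> length hs" "i \<le> hs ! (j - 1)"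
      unfolding hs(2) ferrers_cells_def by auto
    have "hs ! (j - 1) \<le> Max (set hs)" using c by (intro Max_ge) auto
    hence "i \<le> Max (set hs)" using c(4) by (rule order_trans[rotated])
    thus "c \<in> {..length hs} \<times> {..Max (set hs)}" using c by auto
  qed
  hence "finite F" by (rule finite_subset) simp
  moreover have "(x', y') \<in> F" if "(x, y) \<in> F" "0 < x'" "x' \<le> x" "0 < y'" "y' \<le> y" for x y x' y'
  proof -
    have "x \<le> length hs" "y \<le> hs ! (x - 1)"
      using that(1) unfolding hs(2) ferrers_cells_def by auto
    moreover from this have "hs ! (x - 1) \<le> hs ! (x' - 1)" using that by (intro mono) auto
    ultimately show ?thesis using that unfolding hs(2) ferrers_cells_def by auto
  qed
  moreover have "0 < x \<and> 0 < y" if "(x, y) \<in> F" for x y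
    using that unfolding hs(2) ferrers_cells_def by auto
  ultimately show ?thesis unfolding down_closed_def by blast
qed

theorem theorem3:
  fixes F :: "cell set" and n s t :: nat
  assumes "ferrers_shape F" and "s > 0" and "t > 0"
  shows "num_fillings F n s t = num_fillings F n t s"
  using num_fillings_le[OF ferrers_shape_down_closed[OF assms(1)]] by (intro antisym)

end
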